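(* Let $N\ge2$, $\alpha\in(0,2)$, $\Omega\subset\mathbb{R}^N$ bounded open with $0\in\Omega$ and $C^2$ boundary, and $A$ a symmetric uniformly elliptic $C^1(\overline\Omega)$ matrix field. Then $\mathcal{H}_0^1(\Omega)$ is compactly embedded in $L^2(\Omega)$.
   Context: $A:\overline\Omega\to M_{N\times N}(\mathbb{R})$ symmetric, $A_{ij}\in C^1(\overline\Omega)$, $\zeta^TA\zeta\ge\beta|\zeta|^2$ for a constant $\beta>0$. $\mathcal{H}_0^1(\Omega)=\{z\in W_0^{1,1}(\Omega): |x|^\alpha A\nabla z\cdot\nabla z\in L^1(\Omega)\}$ with norm $\|z\|^2_{\mathcal{H}_0^1(\Omega)}=\int_\Omega|x|^\alpha A\nabla z\cdot\nabla z\,dx$. *)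

theory Defs
  imports "HOL-Analysis.Analysis"
begin

coinductive smooth_fun :: "('a::euclidean_space \<Rightarrow> real) \<Rightarrow> bool" where
  "(\<And>x. f differentiable (at x)) \<Longrightarrow>
   (\<And>v. smooth_fun (\<lambda>x. frechet_derivative f (at x) v)) \<Longrightarrow> smooth_fun f"

definition test_fun :: "(real^('n::finite)) set \<Rightarrow> (real^'n \<Rightarrow> real) \<Rightarrow> bool" where
  "test_fun \<Omega> \<phi> \<longleftrightarrow> smooth_fun \<phi> \<and> compact (closure {x. \<phi> x \<noteq> 0})
      \<and> closure {x. \<phi> x \<noteq> 0} \<subseteq> \<Omega>"

definition cgrad :: "(real^'n \<Rightarrow> real) \<Rightarrow> real^'n \<Rightarrow> real^'n" where
  "cgrad \<phi> x = (\<chi> i. frechet_derivative \<phi> (at x) (axis i 1))"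

definition weak_grad :: "(real^'n) set \<Rightarrow> (real^'n \<Rightarrow> real) \<Rightarrow> (real^'n \<Rightarrow> real^'n) \<Rightarrow> bool" where
  "weak_grad \<Omega> z g \<longleftrightarrow> set_integrable lebesgue \<Omega> z
     \<and> (\<forall>i. set_integrable lebesgue \<Omega> (\<lambda>x. g x $ i))
     \<and> (\<forall>\<phi>. test_fun \<Omega> \<phi> \<longrightarrow> (\<forall>i.
          (LINT x:\<Omega>|lebesgue. z x * cgrad \<phi> x $ i) = - (LINT x:\<Omega>|lebesgue. g x $ i * \<phi> x)))"

text \<open>The weak gradient (unique a.e.).\<close>
definition wgrad :: "(real^'n) set \<Rightarrow> (real^'n \<Rightarrow> real) \<Rightarrow> real^'n \<Rightarrow> real^'n" where
  "wgrad \<Omega> z = (SOME g. weak_grad \<Omega> z g)"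

definition W011 :: "(real^'n) set \<Rightarrow> (real^'n \<Rightarrow> real) set" where
  "W011 \<Omega> = {z. (\<exists>g. weak_grad \<Omega> z g) \<and>
     (\<exists>\<phi>s. (\<forall>k. test_fun \<Omega> (\<phi>s k))
        \<and> (\<lambda>k. LINT x:\<Omega>|lebesgue. \<bar>\<phi>s k x - z x\<bar>) \<longlonglongrightarrow> 0
        \<and> (\<lambda>k. LINT x:\<Omega>|lebesgue. norm (cgrad (\<phi>s k) x - wgrad \<Omega> z x)) \<longlonglongrightarrow> 0)}"

definition H01 :: "(real^'n) set \<Rightarrow> (real^'n \<Rightarrow> real^'n^'n) \<Rightarrow> real \<Rightarrow> (real^'n \<Rightarrow> real) set" where
  "H01 \<Omega> A \<alpha> = {z \<in> W011 \<Omega>. set_integrable lebesgue \<Omega>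
      (\<lambda>x. norm x powr \<alpha> * ((A x *v wgrad \<Omega> z x) \<bullet> wgrad \<Omega> z x))}"

definition Hnorm2 :: "(real^'n) set \<Rightarrow> (real^'n \<Rightarrow> real^'n^'n) \<Rightarrow> real \<Rightarrow> (real^'n \<Rightarrow> real) \<Rightarrow> real" where
  "Hnorm2 \<Omega> A \<alpha> z = (LINT x:\<Omega>|lebesgue. norm x powr \<alpha> * ((A x *v wgrad \<Omega> z x) \<bullet> wgrad \<Omega> z x))"

definition L2 :: "(real^'n) set \<Rightarrow> (real^'n \<Rightarrow> real) \<Rightarrow> bool" where
  "L2 \<Omega> w \<longleftrightarrow> w \<in> borel_measurable (lebesgue_on \<Omega>) \<and> set_integrable lebesgue \<Omega> (\<lambda>x. (w x)^2)"

definition C2_on :: "('a::euclidean_space \<Rightarrow> real) \<Rightarrow> 'a set \<Rightarrow> bool" where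
  "C2_on f U \<longleftrightarrow> (\<forall>x\<in>U. f differentiable (at x))
     \<and> (\<forall>v. \<forall>x\<in>U. (\<lambda>y. frechet_derivative f (at y) v) differentiable (at x))
     \<and> (\<forall>v w. continuous_on U
          (\<lambda>y. frechet_derivative (\<lambda>z. frechet_derivative f (at z) v) (at y) w))"

definition C2_boundary :: "('a::euclidean_space) set \<Rightarrow> bool" where
  "C2_boundary \<Omega> \<longleftrightarrow> (\<forall>p\<in>frontier \<Omega>. \<exists>U \<rho>. open U \<and> p \<in> U \<and> C2_on \<rho> U
      \<and> (\<forall>x\<in>U. frechet_derivative \<rho> (at x) \<noteq> (\<lambda>_. 0))
      \<and> \<Omega> \<inter> U = {x\<in>U. \<rho> x < 0})"

text \<open>C^1(closure Omega): C^1 in Omega, continuous on the closure, gradient extends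
  continuously to the closure (equivalently, for bounded Omega, is uniformly continuous on Omega).\<close>
definition C1_closure :: "('a::euclidean_space) set \<Rightarrow> ('a \<Rightarrow> real) \<Rightarrow> bool" where
  "C1_closure \<Omega> a \<longleftrightarrow> continuous_on (closure \<Omega>) a \<and>
     (\<exists>g. (\<forall>x\<in>\<Omega>. (a has_derivative (\<lambda>h. g x \<bullet> h)) (at x)) \<and> uniformly_continuous_on \<Omega> g)"

end

theory Submission
  imports Defs "HOL-Complex_Analysis.Great_Picard"
begin

text \<open>
  For \<open>u\<close> in \<open>W\<^sub>0\<^sup>1\<^sup>,\<^sup>1\<close>, extended by zero, with gradient \<open>G\<close>, the inequality
  \<open>|u(y) - u(x)| \<le> |y - x| \<integral>\<^sub>0\<^sup>1 |G(x + t(y - x))| dt\<close> holds for almost every \<open>x\<close>, where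
  \<open>y = h + l x\<close> with \<open>h\<close> and \<open>l \<ge> 1\<close> fixed; it passes from test functions to their limits.

  Translations (\<open>l = 1\<close>) give equicontinuity of \<open>u\<close> in \<open>L\<^sup>2\<close> away from the origin, where the weight
  \<open>|x|\<^sup>\<alpha>\<close> is bounded below. Dilations (\<open>h = 0\<close>, with \<open>l\<close> so large that \<open>u(l x) = 0\<close>) give Hardy's
  inequality \<open>\<integral>|x|\<^sup>\<alpha>\<^sup>-\<^sup>2 u\<^sup>2 \<le> (2/\<alpha>)\<^sup>2 \<integral>|x|\<^sup>\<alpha> |G|\<^sup>2\<close> in the form
  \<open>\<integral>\<^bsub>|x|<\<epsilon>\<^esub> u\<^sup>2 \<le> (2/\<alpha>)\<^sup>2 \<epsilon>\<^sup>2\<^sup>-\<^sup>\<alpha> \<integral>|x|\<^sup>\<alpha> |G|\<^sup>2\<close>, which bounds \<open>u\<close> in \<open>L\<^sup>2\<close> and, since \<open>\<alpha> < 2\<close>,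
  prevents concentration at the origin. Compactness follows from the Kolmogorov-Riesz criterion,
  proved by comparing \<open>u\<close> with its averages over the cells of a cubical grid.
\<close>

section \<open>Estimates along segments\<close>

text \<open>The Jacobian is kept as a power of \<open>s\<close> with real exponent, so that in the
  Hardy estimate it merges with the other powers of the dilation factor.\<close>

lemma nn_integral_lborel_affine:
  fixes f :: "'a::euclidean_space \<Rightarrow> ennreal"
  assumes [measurable]: "f \<in> borel_measurable borel" and s: "s > 0"
  shows "(\<integral>\<^sup>+x. f (b + s *\<^sub>R x) \<partial>lborel) = ennreal (s powr - real DIM('a)) * (\<integral>\<^sup>+x. f x \<partial>lborel)"
proof -
  have "(\<integral>\<^sup>+x. f x \<partial>lborel) = ennreal (s ^ DIM('a)) * (\<integral>\<^sup>+x. f (b + s *\<^sub>R x) \<partial>lborel)"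
    using s by (subst lborel_affine[of s b])
      (simp_all add: nn_integral_density nn_integral_distr nn_integral_cmult)
  moreover have "s powr - real DIM('a) * s ^ DIM('a) = 1"
    using s by (simp add: powr_minus powr_realpow)
  ultimately show ?thesis
    using s by (simp add: mult.assoc[symmetric] ennreal_mult[symmetric])
qed

text \<open>Fundamental theorem of calculus along the segment from \<open>x\<close> to
  \<open>y\<close>, then Cauchy-Schwarz for the directional derivative. The bound is a nonnegative
  integral, so that it still makes sense when \<open>g\<close> is replaced by a merely measurable
  limit.\<close>

lemma chord_estimate_C1:
  fixes f :: "'a::euclidean_space \<Rightarrow> real"
  assumes deriv: "\<And>x. (f has_derivative (\<lambda>v. g x \<bullet> v)) (at x)"
    and cont: "continuous_on UNIV g"
  shows "ennreal \<bar>f y - f x\<bar> \<le> ennreal (norm (y - x)) *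
    (\<integral>\<^sup>+t. ennreal (norm (g (x + t *\<^sub>R (y - x)))) * indicator {0..1} t \<partial>lborel)"
proof -
  define F where "F t = g (x + t *\<^sub>R (y - x)) \<bullet> (y - x)" for t :: real
  have cF: "continuous_on {0..1} F"
    unfolding F_def by (intro continuous_intros continuous_on_compose2[OF cont]) auto
  have der: "((\<lambda>t. f (x + t *\<^sub>R (y - x))) has_vector_derivative F t) (at t within {0..1})" for t
  proof -
    have "((\<lambda>t. f (x + t *\<^sub>R (y - x))) has_derivative (\<lambda>h. g (x + t *\<^sub>R (y - x)) \<bullet> (h *\<^sub>R (y - x))))
      (at t within {0..1})"
      by (rule has_derivative_compose[OF _ deriv]) (auto intro!: derivative_eq_intros)
    then show ?thesis
      by (simp add: has_vector_derivative_def F_def)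
  qed
  have "(F has_integral f (x + 1 *\<^sub>R (y - x)) - f (x + 0 *\<^sub>R (y - x))) {0..1}"
    by (rule fundamental_theorem_of_calculus) (use der in auto)
  then have "f y - f x = integral {0..1} F"
    by (simp add: integral_unique)
  also have "\<dots> = (LINT t:{0..1}|lborel. F t)"
    by (rule set_borel_integral_eq_integral(2)[symmetric])
      (rule borel_integrable_atLeastAtMost', rule cF)
  finally have eq: "f y - f x = (LINT t|lborel. indicator {0..1} t *\<^sub>R F t)"
    by (simp add: set_lebesgue_integral_def)
  have int: "integrable lborel (\<lambda>t. indicator {0..1} t *\<^sub>R F t)"
    using borel_integrable_atLeastAtMost'[OF cF] by (simp add: set_integrable_def)
  have gm [measurable]: "g \<in> borel_measurable borel"
    using cont by (rule borel_measurable_continuous_onI)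
  have "ennreal \<bar>f y - f x\<bar> \<le> (\<integral>\<^sup>+t. ennreal (norm (indicator {0..1} t *\<^sub>R F t)) \<partial>lborel)"
    unfolding eq using integral_norm_bound_ennreal[OF int] by simp
  also have "\<dots> \<le> (\<integral>\<^sup>+t. ennreal (norm (y - x)) *
      (ennreal (norm (g (x + t *\<^sub>R (y - x)))) * indicator {0..1} t) \<partial>lborel)"
  proof (rule nn_integral_mono)
    fix t :: real
    have "\<bar>F t\<bar> \<le> norm (y - x) * norm (g (x + t *\<^sub>R (y - x)))"
      unfolding F_def using Cauchy_Schwarz_ineq2[of "g (x + t *\<^sub>R (y - x))" "y - x"]
      by (simp add: mult.commute)
    then show "ennreal (norm (indicator {0..1} t *\<^sub>R F t)) \<le> ennreal (norm (y - x)) *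
      (ennreal (norm (g (x + t *\<^sub>R (y - x)))) * indicator {0..1} t)"
      by (auto simp: indicator_def ennreal_mult[symmetric] intro!: ennreal_leI)
  qed
  also have "\<dots> = ennreal (norm (y - x)) *
    (\<integral>\<^sup>+t. ennreal (norm (g (x + t *\<^sub>R (y - x)))) * indicator {0..1} t \<partial>lborel)"
    by (rule nn_integral_cmult) measurable
  finally show ?thesis .
qed

text \<open>Replacing \<open>\<phi> k\<close> and \<open>D\<phi> k\<close> by \<open>u\<close> and
  \<open>G\<close> costs errors at the points
  \<open>t *\<^sub>R h + (1 + t * (l - 1)) *\<^sub>R x\<close> of the segment. For fixed
  \<open>t\<close> in [0, 1] such a point is the image of \<open>x\<close> under a dilation of
  factor at least 1 followed by a translation, which does not increase nonnegative integrals; this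
  is where \<open>l \<ge> 1\<close> enters. Hence the integral over \<open>x\<close> of the total
  error tends to 0.\<close>

lemma chord_estimate_limit:
  fixes u :: "'a::euclidean_space \<Rightarrow> real" and G :: "'a \<Rightarrow> 'a"
    and \<phi> :: "nat \<Rightarrow> 'a \<Rightarrow> real" and D\<phi> :: "nat \<Rightarrow> 'a \<Rightarrow> 'a"
  assumes [measurable]: "u \<in> borel_measurable borel" "G \<in> borel_measurable borel"
      "\<And>k. \<phi> k \<in> borel_measurable borel" "\<And>k. D\<phi> k \<in> borel_measurable borel"
    and lim0: "(\<lambda>k. \<integral>\<^sup>+x. ennreal \<bar>\<phi> k x - u x\<bar> \<partial>lborel) \<longlonglongrightarrow> 0"
    and lim1: "(\<lambda>k. \<integral>\<^sup>+x. ennreal (norm (D\<phi> k x - G x)) \<partial>lborel) \<longlonglongrightarrow> 0"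
    and chord: "\<And>k x y. ennreal \<bar>\<phi> k y - \<phi> k x\<bar> \<le> ennreal (norm (y - x)) *
      (\<integral>\<^sup>+t. ennreal (norm (D\<phi> k (x + t *\<^sub>R (y - x)))) * indicator {0..1} t \<partial>lborel)"
    and l: "l \<ge> 1"
  shows "AE x in lborel. ennreal \<bar>u (h + l *\<^sub>R x) - u x\<bar> \<le> ennreal (norm (h + (l - 1) *\<^sub>R x)) *
      (\<integral>\<^sup>+t. ennreal (norm (G (t *\<^sub>R h + (1 + t * (l - 1)) *\<^sub>R x))) * indicator {0..1} t \<partial>lborel)"
proof -
  define a where "a k = (\<integral>\<^sup>+x. ennreal \<bar>\<phi> k x - u x\<bar> \<partial>lborel)" for k
  define b where "b k = (\<integral>\<^sup>+x. ennreal (norm (D\<phi> k x - G x)) \<partial>lborel)" for k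
  define E where "E k x = (\<integral>\<^sup>+t. ennreal (norm (D\<phi> k (t *\<^sub>R h + (1 + t * (l - 1)) *\<^sub>R x) -
    G (t *\<^sub>R h + (1 + t * (l - 1)) *\<^sub>R x))) * indicator {0..1} t \<partial>lborel)" for k x
  define D where "D k x = ennreal \<bar>\<phi> k x - u x\<bar> +
    ennreal \<bar>\<phi> k (h + l *\<^sub>R x) - u (h + l *\<^sub>R x)\<bar> + E k x" for k x
  have scale: "(\<integral>\<^sup>+x. f (c + s *\<^sub>R x) \<partial>lborel) \<le> (\<integral>\<^sup>+x. f x \<partial>lborel)"
    if [measurable]: "f \<in> borel_measurable borel" and "s \<ge> 1" for f :: "'a \<Rightarrow> ennreal" and c s
  proof -
    have "s powr - real DIM('a) \<le> 1"
      using that by (simp add: powr_minus powr_realpow inverse_le_1_iff)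
    then have "ennreal (s powr - real DIM('a)) \<le> 1"
      by (simp add: ennreal_le_1)
    then show ?thesis
      using that mult_right_mono[of "ennreal (s powr - real DIM('a))" 1 "\<integral>\<^sup>+x. f x \<partial>lborel"]
      by (subst nn_integral_lborel_affine) auto
  qed
  have Em [measurable]: "E k \<in> borel_measurable borel" for k
    unfolding E_def by measurable
  have Dm [measurable]: "D k \<in> borel_measurable borel" for k
    unfolding D_def by measurable
  \<comment> \<open>Fubini moves the integral over \<open>x\<close> inside; for each
    \<open>t\<close> in [0, 1] the affine map has factor \<open>1 + t * (l - 1)\<close>, which is at
    least 1.\<close>
  have Eb: "(\<integral>\<^sup>+x. E k x \<partial>lborel) \<le> b k" for k
  proof -
    have "(\<integral>\<^sup>+x. E k x \<partial>lborel) = (\<integral>\<^sup>+t. (\<integral>\<^sup>+x. ennreal (norm (D\<phi> k (t *\<^sub>R h + (1 + t * (l - 1)) *\<^sub>R x) -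
      G (t *\<^sub>R h + (1 + t * (l - 1)) *\<^sub>R x))) * indicator {0..1} t \<partial>lborel) \<partial>lborel)"
      unfolding E_def by (rule lborel_pair.Fubini') measurable
    also have "\<dots> \<le> (\<integral>\<^sup>+t. b k * indicator {0..1::real} t \<partial>lborel)"
    proof (rule nn_integral_mono)
      fix t :: real
      show "(\<integral>\<^sup>+x. ennreal (norm (D\<phi> k (t *\<^sub>R h + (1 + t * (l - 1)) *\<^sub>R x) -
        G (t *\<^sub>R h + (1 + t * (l - 1)) *\<^sub>R x))) * indicator {0..1} t \<partial>lborel) \<le> b k * indicator {0..1} t"
        using l scale[of "\<lambda>y. ennreal (norm (D\<phi> k y - G y))" "1 + t * (l - 1)" "t *\<^sub>R h"]
        by (auto simp: indicator_def b_def)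
    qed
    also have "\<dots> = b k"
      by (simp add: nn_integral_cmult_indicator)
    finally show ?thesis .
  qed
  have Db: "(\<integral>\<^sup>+x. D k x \<partial>lborel) \<le> a k + a k + b k" for k
  proof -
    have "(\<integral>\<^sup>+x. D k x \<partial>lborel) = a k +
      (\<integral>\<^sup>+x. ennreal \<bar>\<phi> k (h + l *\<^sub>R x) - u (h + l *\<^sub>R x)\<bar> \<partial>lborel) + (\<integral>\<^sup>+x. E k x \<partial>lborel)"
      unfolding D_def a_def by (simp add: nn_integral_add)
    also have "\<dots> \<le> a k + a k + b k"
      using Eb[of k] scale[of "\<lambda>y. ennreal \<bar>\<phi> k y - u y\<bar>" l h] l
      by (intro add_mono) (auto simp: a_def)
    finally show ?thesis .
  qed
  \<comment> \<open>The pointwise infimum of the errors vanishes almost everywhere, so no a.e. convergent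
    subsequence has to be extracted.\<close>
  have "(\<integral>\<^sup>+x. (INF k. D k x) \<partial>lborel) \<le> 0"
  proof (rule LIMSEQ_le_const)
    have "(\<lambda>k. a k + a k + b k) \<longlonglongrightarrow> 0 + 0 + 0"
      using lim0 lim1 unfolding a_def b_def by (intro tendsto_intros)
    then show "(\<lambda>k. a k + a k + b k) \<longlonglongrightarrow> 0" by simp
    show "\<exists>N. \<forall>n\<ge>N. (\<integral>\<^sup>+x. (INF k. D k x) \<partial>lborel) \<le> a n + a n + b n"
      by (intro exI allI impI order_trans[OF nn_integral_mono Db]) (auto intro: INF_lower)
  qed
  then have "AE x in lborel. (INF k. D k x) = 0"
    by (subst (asm) le_zero_eq, subst (asm) nn_integral_0_iff_AE) auto
  then show ?thesis
  proof eventually_elim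
    case (elim x)
    let ?V = "norm (h + (l - 1) *\<^sub>R x)"
    let ?B = "\<integral>\<^sup>+t. ennreal (norm (G (t *\<^sub>R h + (1 + t * (l - 1)) *\<^sub>R x))) * indicator {0..1} t \<partial>lborel"
    \<comment> \<open>The gradient error carries the length \<open>?V\<close> of the segment and the
      function errors carry the factor 1, so together they cost at most
      \<open>(1 + ?V) * D k x\<close>.\<close>
    have step: "ennreal \<bar>u (h + l *\<^sub>R x) - u x\<bar> \<le> ennreal ?V * ?B + ennreal (1 + ?V) * D k x" for k
    proof -
      have p: "x + t *\<^sub>R (h + l *\<^sub>R x - x) = t *\<^sub>R h + (1 + t * (l - 1)) *\<^sub>R x" for t
        by (simp add: algebra_simps)
      have n: "norm (h + l *\<^sub>R x - x) = ?V"
        by (simp add: algebra_simps)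
      have "(\<integral>\<^sup>+t. ennreal (norm (D\<phi> k (t *\<^sub>R h + (1 + t * (l - 1)) *\<^sub>R x))) * indicator {0..1} t \<partial>lborel)
        \<le> (\<integral>\<^sup>+t. ennreal (norm (G (t *\<^sub>R h + (1 + t * (l - 1)) *\<^sub>R x))) * indicator {0..1} t +
          ennreal (norm (D\<phi> k (t *\<^sub>R h + (1 + t * (l - 1)) *\<^sub>R x) -
            G (t *\<^sub>R h + (1 + t * (l - 1)) *\<^sub>R x))) * indicator {0..1} t \<partial>lborel)"
        by (intro nn_integral_mono)
          (auto simp: indicator_def ennreal_plus[symmetric] simp del: ennreal_plus
            intro!: ennreal_leI norm_triangle_sub)
      also have "\<dots> = ?B + E k x"
        unfolding E_def by (rule nn_integral_add) measurable
      finally have 1: "ennreal \<bar>\<phi> k (h + l *\<^sub>R x) - \<phi> k x\<bar> \<le> ennreal ?V * (?B + E k x)"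
        using chord[of k "h + l *\<^sub>R x" x] unfolding p n
        by (meson order_trans mult_left_mono zero_le)
      have "ennreal \<bar>u (h + l *\<^sub>R x) - u x\<bar> \<le> ennreal (\<bar>\<phi> k (h + l *\<^sub>R x) - \<phi> k x\<bar> +
        \<bar>\<phi> k x - u x\<bar> + \<bar>\<phi> k (h + l *\<^sub>R x) - u (h + l *\<^sub>R x)\<bar>)"
        by (rule ennreal_leI) linarith
      also have "\<dots> = ennreal \<bar>\<phi> k (h + l *\<^sub>R x) - \<phi> k x\<bar> + (ennreal \<bar>\<phi> k x - u x\<bar> +
         ennreal \<bar>\<phi> k (h + l *\<^sub>R x) - u (h + l *\<^sub>R x)\<bar>)"
        by (simp add: add.assoc)
      also have "\<dots> \<le> ennreal ?V * (?B + E k x) + D k x"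
        using 1 by (intro add_mono) (auto simp: D_def)
      also have "\<dots> = ennreal ?V * ?B + (ennreal ?V * E k x + D k x)"
        by (simp add: distrib_left add.assoc)
      also have "\<dots> \<le> ennreal ?V * ?B + (ennreal ?V * D k x + D k x)"
        by (intro add_mono mult_left_mono) (auto simp: D_def)
      also have "\<dots> = ennreal ?V * ?B + ennreal (1 + ?V) * D k x"
        by (simp add: distrib_right add.commute)
      finally show ?thesis .
    qed
    \<comment> \<open>Since the infimum is 0, some \<open>k\<close>, which may depend on
      \<open>x\<close>, satisfies \<open>D k x < e / (1 + ?V)\<close>.\<close>
    have "ennreal \<bar>u (h + l *\<^sub>R x) - u x\<bar> \<le> ennreal ?V * ?B + ennreal e" if "e > 0" for e
    proof -
      have "(INF k. D k x) < ennreal (e / (1 + ?V))"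
        using elim that by (simp add: add_pos_nonneg)
      then obtain k where k: "D k x < ennreal (e / (1 + ?V))"
        by (auto simp: INF_less_iff)
      have "ennreal (1 + ?V) * D k x \<le> ennreal (1 + ?V) * ennreal (e / (1 + ?V))"
        using k by (intro mult_left_mono) auto
      also have "\<dots> = ennreal e"
        using that by (subst ennreal_mult[symmetric]) (auto simp: add_nonneg_eq_0_iff)
      finally show ?thesis
        using step[of k] by (meson add_left_mono order_trans)
    qed
    then show ?case
      by (blast intro: ennreal_le_epsilon)
  qed
qed

text \<open>The link between \<open>u\<close> and \<open>G\<close> on which the later estimates
  rest: \<open>l = 1\<close> gives translations, \<open>h = 0\<close> gives dilations. The argument
  of \<open>G\<close> is the point with parameter \<open>t\<close> on the segment from
  \<open>x\<close> to \<open>h + l *\<^sub>R x\<close>. The exceptional null set may depend on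
  \<open>l\<close> and \<open>h\<close>.\<close>

definition chord_bounded :: "('a::euclidean_space \<Rightarrow> real) \<Rightarrow> ('a \<Rightarrow> 'a) \<Rightarrow> bool" where
  "chord_bounded u G \<longleftrightarrow> (\<forall>l\<ge>1. \<forall>h. AE x in lborel.
    ennreal \<bar>u (h + l *\<^sub>R x) - u x\<bar> \<le> ennreal (norm (h + (l - 1) *\<^sub>R x)) *
      (\<integral>\<^sup>+t. ennreal (norm (G (t *\<^sub>R h + (1 + t * (l - 1)) *\<^sub>R x))) * indicator {0..1} t \<partial>lborel))"

section \<open>Weighted Cauchy-Schwarz on the unit interval\<close>

text \<open>Cauchy-Schwarz for \<open>sqrt p\<close> and \<open>sqrt q\<close>. Writing the product
  under one root leaves \<open>p\<close> free as a weight: the constant 1 for translations, a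
  decaying power for dilations.\<close>

lemma nn_integral_sqrt_mult_squared_le:
  fixes p q :: "real \<Rightarrow> real"
  assumes [measurable]: "p \<in> borel_measurable borel" "q \<in> borel_measurable borel"
    and nonneg: "\<And>t. t \<in> {0..1} \<Longrightarrow> 0 \<le> p t" "\<And>t. t \<in> {0..1} \<Longrightarrow> 0 \<le> q t"
  shows "(\<integral>\<^sup>+t. ennreal (sqrt (p t * q t)) * indicator {0..1} t \<partial>lborel)\<^sup>2 \<le>
    (\<integral>\<^sup>+t. ennreal (p t) * indicator {0..1} t \<partial>lborel) *
    (\<integral>\<^sup>+t. ennreal (q t) * indicator {0..1} t \<partial>lborel)"
proof -
  let ?I = "indicator {0..1::real} :: real \<Rightarrow> ennreal"
  have "(\<integral>\<^sup>+t. ennreal (sqrt (p t * q t)) * ?I t \<partial>lborel)\<^sup>2 =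
      (\<integral>\<^sup>+t. (ennreal (sqrt (p t)) * ?I t) * (ennreal (sqrt (q t)) * ?I t) \<partial>lborel)\<^sup>2"
    using nonneg by (intro arg_cong[where f="\<lambda>x. x\<^sup>2"] nn_integral_cong)
      (auto simp: indicator_def real_sqrt_mult ennreal_mult)
  also have "\<dots> \<le> (\<integral>\<^sup>+t. (ennreal (sqrt (p t)) * ?I t)\<^sup>2 \<partial>lborel) *
      (\<integral>\<^sup>+t. (ennreal (sqrt (q t)) * ?I t)\<^sup>2 \<partial>lborel)"
    by (rule Cauchy_Schwarz_nn_integral) measurable
  also have "(\<integral>\<^sup>+t. (ennreal (sqrt (p t)) * ?I t)\<^sup>2 \<partial>lborel) = (\<integral>\<^sup>+t. ennreal (p t) * ?I t \<partial>lborel)"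
    using nonneg by (intro nn_integral_cong) (auto simp: indicator_def ennreal_power)
  also have "(\<integral>\<^sup>+t. (ennreal (sqrt (q t)) * ?I t)\<^sup>2 \<partial>lborel) = (\<integral>\<^sup>+t. ennreal (q t) * ?I t \<partial>lborel)"
    using nonneg by (intro nn_integral_cong) (auto simp: indicator_def ennreal_power)
  finally show ?thesis .
qed

text \<open>With s = 1 + t c this is the integral of s^(-1-b) over [1, 1+c]. The point is a bound
  independent of \<open>c\<close>, because \<open>c\<close> grows without limit in the Hardy
  estimate.\<close>

lemma nn_integral_segment_powr_le:
  fixes b c :: real
  assumes b: "b > 0" and c: "c \<ge> 0"
  shows "(\<integral>\<^sup>+t. ennreal (c * (1 + t * c) powr - (1 + b)) * indicator {0..1} t \<partial>lborel) \<le> ennreal (1 / b)"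
proof -
  have "(\<integral>\<^sup>+t. ennreal (c * (1 + t * c) powr - (1 + b)) * indicator {0..1} t \<partial>lborel) =
     ennreal (- (1 / b) * (1 + 1 * c) powr - b - - (1 / b) * (1 + 0 * c) powr - b)"
  proof (rule nn_integral_FTC_Icc[where F="\<lambda>t. - (1 / b) * (1 + t * c) powr - b"])
    fix t :: real assume "t \<in> {0..1}"
    then have pos: "1 + t * c > 0" using c by (auto intro: add_pos_nonneg)
    have "((\<lambda>t. - (1 / b) * (1 + t * c) powr - b) has_real_derivative
       - (1 / b) * (- b * (1 + t * c) powr (- b - 1) * c)) (at t)"
      using pos by (auto intro!: derivative_eq_intros)
    also have "- (1 / b) * (- b * (1 + t * c) powr (- b - 1) * c) = c * (1 + t * c) powr - (1 + b)"
    proof -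
      have "- b - 1 = - (1 + b)" by simp
      then show ?thesis using b by (simp only:) simp
    qed
    finally show "((\<lambda>t. - (1 / b) * (1 + t * c) powr - b) has_real_derivative
       c * (1 + t * c) powr - (1 + b)) (at t)" .
    show "0 \<le> c * (1 + t * c) powr - (1 + b)" using c by simp
  qed (use c in auto)
  also have "\<dots> \<le> ennreal (1 / b)"
    using b by (intro ennreal_leI) simp
  finally show ?thesis .
qed

section \<open>Translations away from the origin and Hardy's inequality near it\<close>

text \<open>For |x| \<ge> 2 \<epsilon> and |h| \<le> \<epsilon> the segment from x to h + x stays
  outside the open ball of radius \<epsilon>. There the weight is at least
  \<open>\<epsilon> powr \<alpha>\<close> and can be inserted at the price
  \<open>\<epsilon> powr - \<alpha>\<close>. Fubini and translation invariance then remove the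
  integral over \<open>t\<close>.\<close>

lemma translation_estimate:
  fixes u :: "'a::euclidean_space \<Rightarrow> real" and G :: "'a \<Rightarrow> 'a"
  assumes [measurable]: "u \<in> borel_measurable borel" "G \<in> borel_measurable borel"
    and chord: "chord_bounded u G"
    and e: "\<epsilon> > 0" and a: "\<alpha> \<ge> 0" and h: "norm h \<le> \<epsilon>"
  shows "(\<integral>\<^sup>+x. ennreal ((u (h + x) - u x)\<^sup>2) * indicator {x. 2 * \<epsilon> \<le> norm x} x \<partial>lborel) \<le>
    ennreal ((norm h)\<^sup>2 * \<epsilon> powr - \<alpha>) * (\<integral>\<^sup>+x. ennreal (norm x powr \<alpha> * (norm (G x))\<^sup>2) \<partial>lborel)"
proof -
  define W where "W x = norm x powr \<alpha> * (norm (G x))\<^sup>2" for x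
  have [measurable]: "W \<in> borel_measurable borel" unfolding W_def by measurable
  let ?I = "indicator {0..1::real} :: real \<Rightarrow> ennreal"
  let ?C = "ennreal ((norm h)\<^sup>2 * \<epsilon> powr - \<alpha>)"
  have "AE x in lborel. ennreal \<bar>u (h + 1 *\<^sub>R x) - u x\<bar> \<le> ennreal (norm (h + (1 - 1) *\<^sub>R x)) *
      (\<integral>\<^sup>+t. ennreal (norm (G (t *\<^sub>R h + (1 + t * (1 - 1)) *\<^sub>R x))) * ?I t \<partial>lborel)"
    using chord unfolding chord_bounded_def by blast
  then have "AE x in lborel. ennreal ((u (h + x) - u x)\<^sup>2) * indicator {x. 2 * \<epsilon> \<le> norm x} x \<le>
    ?C * (\<integral>\<^sup>+t. ennreal (W (t *\<^sub>R h + x)) * ?I t \<partial>lborel)"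
  proof eventually_elim
    case (elim x)
    let ?f = "\<lambda>t. (norm (G (t *\<^sub>R h + x)))\<^sup>2"
    show ?case
    proof (cases "2 * \<epsilon> \<le> norm x")
      case True
      have "ennreal ((u (h + x) - u x)\<^sup>2) = (ennreal \<bar>u (h + x) - u x\<bar>)\<^sup>2"
        by (simp add: ennreal_power)
      \<comment> \<open>The factor 1 under the root prepares Cauchy-Schwarz with the constant
        weight.\<close>
      also have "\<dots> \<le> (ennreal (norm h) * (\<integral>\<^sup>+t. ennreal (sqrt (1 * ?f t)) * ?I t \<partial>lborel))\<^sup>2"
        using elim by (intro power_mono) auto
      also have "\<dots> \<le> ennreal ((norm h)\<^sup>2) * ((\<integral>\<^sup>+t. ennreal 1 * ?I t \<partial>lborel) *
         (\<integral>\<^sup>+t. ennreal (?f t) * ?I t \<partial>lborel))"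
        unfolding power_mult_distrib ennreal_power[OF norm_ge_zero]
        by (intro mult_left_mono nn_integral_sqrt_mult_squared_le) auto
      also have "\<dots> = ennreal ((norm h)\<^sup>2) * (\<integral>\<^sup>+t. ennreal (?f t) * ?I t \<partial>lborel)"
        by simp
      also have "\<dots> \<le> ennreal ((norm h)\<^sup>2) *
          (\<integral>\<^sup>+t. ennreal (\<epsilon> powr - \<alpha>) * (ennreal (W (t *\<^sub>R h + x)) * ?I t) \<partial>lborel)"
      proof (intro mult_left_mono nn_integral_mono)
        fix t :: real
        show "ennreal (?f t) * ?I t \<le> ennreal (\<epsilon> powr - \<alpha>) * (ennreal (W (t *\<^sub>R h + x)) * ?I t)"
        proof (cases "t \<in> {0..1}")
          case t: True
          have "norm (t *\<^sub>R h) \<le> \<epsilon>"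
            using t h mult_mono[of t 1 "norm h" \<epsilon>] by auto
          then have "\<epsilon> \<le> norm (t *\<^sub>R h + x)"
            using True norm_triangle_ineq4[of "t *\<^sub>R h + x" "t *\<^sub>R h"] by simp
          then have "\<epsilon> powr \<alpha> \<le> norm (t *\<^sub>R h + x) powr \<alpha>"
            using e a by (intro powr_mono2) auto
          then have "1 \<le> \<epsilon> powr - \<alpha> * norm (t *\<^sub>R h + x) powr \<alpha>"
            using e by (simp add: powr_minus field_simps)
          then have "?f t \<le> \<epsilon> powr - \<alpha> * W (t *\<^sub>R h + x)"
            unfolding W_def using mult_right_mono[of 1 _ "?f t"] by (fastforce simp: mult.assoc)
          then show ?thesis
            using t by (simp add: ennreal_mult[symmetric] W_def ennreal_leI)
        qed auto
      qed auto
      also have "\<dots> = ?C * (\<integral>\<^sup>+t. ennreal (W (t *\<^sub>R h + x)) * ?I t \<partial>lborel)"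
        by (subst nn_integral_cmult) (auto simp: ennreal_mult mult.assoc)
      finally show ?thesis using True by simp
    qed auto
  qed
  then have "(\<integral>\<^sup>+x. ennreal ((u (h + x) - u x)\<^sup>2) * indicator {x. 2 * \<epsilon> \<le> norm x} x \<partial>lborel) \<le>
    (\<integral>\<^sup>+x. ?C * (\<integral>\<^sup>+t. ennreal (W (t *\<^sub>R h + x)) * ?I t \<partial>lborel) \<partial>lborel)"
    by (rule nn_integral_mono_AE)
  also have "\<dots> = ?C * (\<integral>\<^sup>+x. (\<integral>\<^sup>+t. ennreal (W (t *\<^sub>R h + x)) * ?I t \<partial>lborel) \<partial>lborel)"
    by (rule nn_integral_cmult) measurable
  also have "(\<integral>\<^sup>+x. (\<integral>\<^sup>+t. ennreal (W (t *\<^sub>R h + x)) * ?I t \<partial>lborel) \<partial>lborel) =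
      (\<integral>\<^sup>+t. (\<integral>\<^sup>+x. ennreal (W (t *\<^sub>R h + x)) * ?I t \<partial>lborel) \<partial>lborel)"
    by (rule lborel_pair.Fubini') measurable
  also have "\<dots> = (\<integral>\<^sup>+t. (\<integral>\<^sup>+x. ennreal (W x) \<partial>lborel) * ?I t \<partial>lborel)"
  proof (rule nn_integral_cong)
    fix t :: real
    show "(\<integral>\<^sup>+x. ennreal (W (t *\<^sub>R h + x)) * ?I t \<partial>lborel) = (\<integral>\<^sup>+x. ennreal (W x) \<partial>lborel) * ?I t"
      using nn_integral_lborel_affine[of "\<lambda>x. ennreal (W x)" 1 "t *\<^sub>R h"]
      by (simp add: nn_integral_multc)
  qed
  also have "\<dots> = (\<integral>\<^sup>+x. ennreal (W x) \<partial>lborel)"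
    by (simp add: nn_integral_cmult_indicator)
  finally show ?thesis unfolding W_def .
qed

text \<open>Compare \<open>u x\<close> with the value 0 of \<open>u\<close> at a dilated point
  beyond radius \<open>R\<close>. On an annulus \<delta> \<le> |x| < \<epsilon> one dilation factor
  serves all points, and the resulting constant is independent of \<delta>, so \<delta> may tend to
  0. The factor 2/\<alpha> appears twice: once from Cauchy-Schwarz and once from the powers left by
  the change of variables.\<close>

lemma weighted_Hardy_estimate:
  fixes u :: "'a::euclidean_space \<Rightarrow> real" and G :: "'a \<Rightarrow> 'a"
  assumes [measurable]: "u \<in> borel_measurable borel" "G \<in> borel_measurable borel"
    and chord: "chord_bounded u G"
    and supp: "\<And>x. R \<le> norm x \<Longrightarrow> u x = 0" and R: "R > 0"
    and a: "0 < \<alpha>" "\<alpha> < 2" and dim: "DIM('a) \<ge> 2" and e: "\<epsilon> > 0"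
  shows "(\<integral>\<^sup>+x. ennreal ((u x)\<^sup>2) * indicator (ball 0 \<epsilon>) x \<partial>lborel) \<le>
    ennreal ((2 / \<alpha>)\<^sup>2 * \<epsilon> powr (2 - \<alpha>)) * (\<integral>\<^sup>+x. ennreal (norm x powr \<alpha> * (norm (G x))\<^sup>2) \<partial>lborel)"
    (is "_ \<le> ?rhs")
proof -
  define W where "W x = norm x powr \<alpha> * (norm (G x))\<^sup>2" for x
  have [measurable]: "W \<in> borel_measurable borel" unfolding W_def by measurable
  have W0: "W x \<ge> 0" for x by (simp add: W_def)
  let ?I = "indicator {0..1::real} :: real \<Rightarrow> ennreal"
  let ?K = "ennreal (2 / \<alpha>)"
  have annulus: "(\<integral>\<^sup>+x. ennreal ((u x)\<^sup>2) * indicator {x. \<delta> \<le> norm x \<and> norm x < \<epsilon>} x \<partial>lborel) \<le> ?rhs"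
    if d: "\<delta> > 0" for \<delta>
  proof -
    \<comment> \<open>This makes \<open>(1 + c) * norm x \<ge> R\<close> whenever
      \<open>norm x \<ge> \<delta>\<close>, so \<open>u\<close> vanishes at the dilated
      point.\<close>
    define c where "c = R / \<delta>"
    have c: "c > 0" using R d by (simp add: c_def)
    define s where "s t = 1 + t * c" for t
    have [measurable]: "s \<in> borel_measurable borel" unfolding s_def by measurable
    have s1: "s t \<ge> 1" if "t \<in> {0..1}" for t using that c by (simp add: s_def)
    have J: "(\<integral>\<^sup>+t. ennreal (c * s t powr - (1 + \<alpha> / 2)) * ?I t \<partial>lborel) \<le> ?K"
      using nn_integral_segment_powr_le[of "\<alpha> / 2" c] a c by (simp add: s_def)
    have "1 \<le> 1 + c" using c by simp
    then have "AE x in lborel. ennreal \<bar>u (0 + (1 + c) *\<^sub>R x) - u x\<bar> \<le> ennreal (norm (0 + (1 + c - 1) *\<^sub>R x)) *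
      (\<integral>\<^sup>+t. ennreal (norm (G (t *\<^sub>R 0 + (1 + t * (1 + c - 1)) *\<^sub>R x))) * ?I t \<partial>lborel)"
      using chord unfolding chord_bounded_def by blast
    then have "AE x in lborel. ennreal ((u x)\<^sup>2) * indicator {x. \<delta> \<le> norm x \<and> norm x < \<epsilon>} x \<le>
      ?K * ennreal (\<epsilon> powr (2 - \<alpha>)) *
        (\<integral>\<^sup>+t. ennreal (c * s t powr (1 + \<alpha> / 2 - \<alpha>)) * ennreal (W (s t *\<^sub>R x)) * ?I t \<partial>lborel)"
    proof eventually_elim
      case (elim x)
      show ?case
      proof (cases "\<delta> \<le> norm x \<and> norm x < \<epsilon>")
        case True
        have "R \<le> norm ((1 + c) *\<^sub>R x)"
        proof -
          have "R = c * \<delta>" using d by (simp add: c_def)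
          also have "\<dots> \<le> (1 + c) * norm x" using True c d by (intro mult_mono) auto
          finally show ?thesis using c by simp
        qed
        then have u0: "u ((1 + c) *\<^sub>R x) = 0" by (rule supp)
        \<comment> \<open>Cauchy-Schwarz with the weight \<open>s powr - (1 + \<alpha> / 2)\<close> in \<open>s = 1 + t c\<close>: its integral is at most
          \<open>2 / \<alpha>\<close> whatever \<open>c\<close> is, and, as the dimension is at least 2, so is the integral of the
          factor left by the change of variables \<open>x \<mapsto> s x\<close>.\<close>
        let ?p = "\<lambda>t. c * s t powr - (1 + \<alpha> / 2)"
        let ?q = "\<lambda>t. c * s t powr (1 + \<alpha> / 2) * (norm (G (s t *\<^sub>R x)))\<^sup>2"
        have "ennreal (norm (c *\<^sub>R x)) * (\<integral>\<^sup>+t. ennreal (norm (G (s t *\<^sub>R x))) * ?I t \<partial>lborel) =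
           ennreal (norm x) * (\<integral>\<^sup>+t. ennreal c * (ennreal (norm (G (s t *\<^sub>R x))) * ?I t) \<partial>lborel)"
          using c by (subst nn_integral_cmult) (auto simp: ennreal_mult mult_ac)
        also have "(\<integral>\<^sup>+t. ennreal c * (ennreal (norm (G (s t *\<^sub>R x))) * ?I t) \<partial>lborel) =
          (\<integral>\<^sup>+t. ennreal (sqrt (?p t * ?q t)) * ?I t \<partial>lborel)"
        proof (rule nn_integral_cong)
          fix t :: real
          show "ennreal c * (ennreal (norm (G (s t *\<^sub>R x))) * ?I t) = ennreal (sqrt (?p t * ?q t)) * ?I t"
          proof (cases "t \<in> {0..1}")
            case t: True
            have "?p t * ?q t = (c * norm (G (s t *\<^sub>R x)))\<^sup>2"
              using s1[OF t] by (simp add: powr_minus power2_eq_square field_simps)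
            then show ?thesis using t c by (simp add: ennreal_mult real_sqrt_mult real_sqrt_abs)
          qed auto
        qed
        finally have 1: "ennreal \<bar>u x\<bar> \<le> ennreal (norm x) * (\<integral>\<^sup>+t. ennreal (sqrt (?p t * ?q t)) * ?I t \<partial>lborel)"
          using elim u0 by (simp add: s_def)
        have "ennreal ((u x)\<^sup>2) = (ennreal \<bar>u x\<bar>)\<^sup>2"
          by (simp add: ennreal_power)
        also have "\<dots> \<le> (ennreal (norm x) * (\<integral>\<^sup>+t. ennreal (sqrt (?p t * ?q t)) * ?I t \<partial>lborel))\<^sup>2"
          using 1 by (intro power_mono) auto
        also have "\<dots> \<le> ennreal ((norm x)\<^sup>2) * ((\<integral>\<^sup>+t. ennreal (?p t) * ?I t \<partial>lborel) *
             (\<integral>\<^sup>+t. ennreal (?q t) * ?I t \<partial>lborel))"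
          unfolding power_mult_distrib ennreal_power[OF norm_ge_zero]
          using c by (intro mult_left_mono nn_integral_sqrt_mult_squared_le) auto
        also have "\<dots> \<le> ennreal (\<epsilon> powr (2 - \<alpha>) * norm x powr \<alpha>) * (?K * (\<integral>\<^sup>+t. ennreal (?q t) * ?I t \<partial>lborel))"
        proof (intro mult_mono ennreal_leI J)
          have x0: "norm x > 0" using True d by linarith
          \<comment> \<open>One factor is at most \<open>\<epsilon> powr (2 - \<alpha>)\<close>
            because \<alpha> < 2; the other, together with \<open>s t powr \<alpha>\<close>, becomes
            the weight inside \<open>W (s t *\<^sub>R x)\<close>.\<close>
          have "(norm x)\<^sup>2 = norm x powr (2 - \<alpha>) * norm x powr \<alpha>"
            using x0 by (simp add: powr_add[symmetric])
          also have "\<dots> \<le> \<epsilon> powr (2 - \<alpha>) * norm x powr \<alpha>"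
            using True a by (intro mult_right_mono powr_mono2) auto
          finally show "(norm x)\<^sup>2 \<le> \<epsilon> powr (2 - \<alpha>) * norm x powr \<alpha>" .
        qed auto
        also have "\<dots> = ?K * ennreal (\<epsilon> powr (2 - \<alpha>)) *
            (ennreal (norm x powr \<alpha>) * (\<integral>\<^sup>+t. ennreal (?q t) * ?I t \<partial>lborel))"
          by (simp add: ennreal_mult mult_ac)
        also have "ennreal (norm x powr \<alpha>) * (\<integral>\<^sup>+t. ennreal (?q t) * ?I t \<partial>lborel) =
          (\<integral>\<^sup>+t. ennreal (norm x powr \<alpha>) * (ennreal (?q t) * ?I t) \<partial>lborel)"
          by (rule nn_integral_cmult[symmetric]) measurable
        also have "\<dots> = (\<integral>\<^sup>+t. ennreal (c * s t powr (1 + \<alpha> / 2 - \<alpha>)) * ennreal (W (s t *\<^sub>R x)) * ?I t \<partial>lborel)"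
        proof (rule nn_integral_cong)
          fix t :: real
          show "ennreal (norm x powr \<alpha>) * (ennreal (?q t) * ?I t) =
            ennreal (c * s t powr (1 + \<alpha> / 2 - \<alpha>)) * ennreal (W (s t *\<^sub>R x)) * ?I t"
          proof (cases "t \<in> {0..1}")
            case t: True
            have sp: "s t > 0" using s1[OF t] by linarith
            have "norm x powr \<alpha> * ?q t = c * s t powr (1 + \<alpha> / 2 - \<alpha>) * W (s t *\<^sub>R x)"
            proof -
              have "s t powr (1 + \<alpha> / 2) = s t powr (1 + \<alpha> / 2 - \<alpha>) * s t powr \<alpha>"
                by (simp add: powr_add[symmetric] add.commute)
              then show ?thesis
                using sp by (simp only: W_def norm_scaleR powr_mult abs_of_pos) (simp add: mult_ac)
            qed
            then show ?thesis
              using t c W0 by (simp add: ennreal_mult[symmetric])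
          qed auto
        qed
        finally show ?thesis using True by simp
      qed auto
    qed
    then have "(\<integral>\<^sup>+x. ennreal ((u x)\<^sup>2) * indicator {x. \<delta> \<le> norm x \<and> norm x < \<epsilon>} x \<partial>lborel) \<le>
      (\<integral>\<^sup>+x. ?K * ennreal (\<epsilon> powr (2 - \<alpha>)) *
        (\<integral>\<^sup>+t. ennreal (c * s t powr (1 + \<alpha> / 2 - \<alpha>)) * ennreal (W (s t *\<^sub>R x)) * ?I t \<partial>lborel) \<partial>lborel)"
      by (rule nn_integral_mono_AE)
    also have "\<dots> = ?K * ennreal (\<epsilon> powr (2 - \<alpha>)) * (\<integral>\<^sup>+x.
        (\<integral>\<^sup>+t. ennreal (c * s t powr (1 + \<alpha> / 2 - \<alpha>)) * ennreal (W (s t *\<^sub>R x)) * ?I t \<partial>lborel) \<partial>lborel)"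
      by (rule nn_integral_cmult) measurable
    also have "\<dots> \<le> ?K * ennreal (\<epsilon> powr (2 - \<alpha>)) * (?K * (\<integral>\<^sup>+x. ennreal (W x) \<partial>lborel))"
    proof (intro mult_left_mono)
      have "(\<integral>\<^sup>+x. (\<integral>\<^sup>+t. ennreal (c * s t powr (1 + \<alpha> / 2 - \<alpha>)) * ennreal (W (s t *\<^sub>R x)) * ?I t \<partial>lborel) \<partial>lborel) =
        (\<integral>\<^sup>+t. (\<integral>\<^sup>+x. ennreal (c * s t powr (1 + \<alpha> / 2 - \<alpha>)) * ennreal (W (s t *\<^sub>R x)) * ?I t \<partial>lborel) \<partial>lborel)"
        by (rule lborel_pair.Fubini') measurable
      also have "\<dots> \<le> (\<integral>\<^sup>+t. (ennreal (c * s t powr - (1 + \<alpha> / 2)) * ?I t) * (\<integral>\<^sup>+x. ennreal (W x) \<partial>lborel) \<partial>lborel)"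
      proof (rule nn_integral_mono)
        fix t :: real
        show "(\<integral>\<^sup>+x. ennreal (c * s t powr (1 + \<alpha> / 2 - \<alpha>)) * ennreal (W (s t *\<^sub>R x)) * ?I t \<partial>lborel) \<le>
          (ennreal (c * s t powr - (1 + \<alpha> / 2)) * ?I t) * (\<integral>\<^sup>+x. ennreal (W x) \<partial>lborel)"
        proof (cases "t \<in> {0..1}")
          case t: True
          have sp: "s t > 0" using s1[OF t] by linarith
          have "(\<integral>\<^sup>+x. ennreal (W (s t *\<^sub>R x)) \<partial>lborel) = ennreal (s t powr - real DIM('a)) * (\<integral>\<^sup>+x. ennreal (W x) \<partial>lborel)"
            using nn_integral_lborel_affine[of "\<lambda>x. ennreal (W x)" "s t" 0] sp by simp
          then have "(\<integral>\<^sup>+x. ennreal (c * s t powr (1 + \<alpha> / 2 - \<alpha>)) * ennreal (W (s t *\<^sub>R x)) * ?I t \<partial>lborel) =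
            ennreal (c * s t powr (1 + \<alpha> / 2 - \<alpha>) * s t powr - real DIM('a)) * (\<integral>\<^sup>+x. ennreal (W x) \<partial>lborel)"
            using t c by (simp add: nn_integral_cmult ennreal_mult mult.assoc)
          also have "c * s t powr (1 + \<alpha> / 2 - \<alpha>) * s t powr - real DIM('a) = c * s t powr (1 + \<alpha> / 2 - \<alpha> - real DIM('a))"
            by (simp add: powr_add[symmetric])
          \<comment> \<open>The terms \<alpha>/2 cancel, and the comparison of exponents says
            exactly that the dimension is at least 2.\<close>
          also have "ennreal \<dots> \<le> ennreal (c * s t powr - (1 + \<alpha> / 2))"
            using s1[OF t] c dim by (intro ennreal_leI mult_left_mono powr_mono) (auto simp: field_simps)
          finally show ?thesis using t by (simp add: mult_right_mono)
        qed auto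
      qed
      also have "\<dots> = (\<integral>\<^sup>+t. ennreal (c * s t powr - (1 + \<alpha> / 2)) * ?I t \<partial>lborel) * (\<integral>\<^sup>+x. ennreal (W x) \<partial>lborel)"
        by (rule nn_integral_multc) measurable
      also have "\<dots> \<le> ?K * (\<integral>\<^sup>+x. ennreal (W x) \<partial>lborel)"
        by (intro mult_right_mono J) auto
      finally show "(\<integral>\<^sup>+x. (\<integral>\<^sup>+t. ennreal (c * s t powr (1 + \<alpha> / 2 - \<alpha>)) *
        ennreal (W (s t *\<^sub>R x)) * ?I t \<partial>lborel) \<partial>lborel) \<le> ?K * (\<integral>\<^sup>+x. ennreal (W x) \<partial>lborel)" .
    qed auto
    also have "\<dots> = ennreal (2 / \<alpha> * \<epsilon> powr (2 - \<alpha>) * (2 / \<alpha>)) * (\<integral>\<^sup>+x. ennreal (W x) \<partial>lborel)"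
    proof -
      have "0 \<le> 2 / \<alpha>" using a by simp
      then show ?thesis by (simp only: ennreal_mult mult_nonneg_nonneg powr_ge_zero mult.assoc)
    qed
    also have "2 / \<alpha> * \<epsilon> powr (2 - \<alpha>) * (2 / \<alpha>) = (2 / \<alpha>)\<^sup>2 * \<epsilon> powr (2 - \<alpha>)"
      by (simp add: power2_eq_square)
    finally show ?thesis unfolding W_def .
  qed
  \<comment> \<open>The annuli with inner radius 1/(n+1) exhaust the punctured ball, and the origin
    is a null set, so monotone convergence yields the ball.\<close>
  let ?F = "\<lambda>n x. ennreal ((u x)\<^sup>2) * indicator {x. 1 / real (Suc n) \<le> norm x \<and> norm x < \<epsilon>} x"
  have "AE x in lborel. x \<noteq> (0::'a)"
    by (rule AE_lborel_singleton)
  then have "(\<integral>\<^sup>+x. ennreal ((u x)\<^sup>2) * indicator (ball 0 \<epsilon>) x \<partial>lborel) \<le> (\<integral>\<^sup>+x. (SUP n. ?F n x) \<partial>lborel)"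
  proof (intro nn_integral_mono_AE, eventually_elim)
    case (elim x)
    then obtain n where n: "inverse (real (Suc n)) < norm x"
      using reals_Archimedean[of "norm x"] by auto
    then have "ennreal ((u x)\<^sup>2) * indicator (ball 0 \<epsilon>) x \<le> ?F n x"
      by (auto simp: indicator_def inverse_eq_divide)
    then show ?case by (rule order_trans) (auto intro: SUP_upper)
  qed
  also have "\<dots> = (SUP n. \<integral>\<^sup>+x. ?F n x \<partial>lborel)"
  proof (rule nn_integral_monotone_convergence_SUP)
    show "incseq ?F"
    proof (intro incseq_SucI le_funI)
      fix n x
      have "1 / real (Suc (Suc n)) \<le> 1 / real (Suc n)" by (simp add: frac_le)
      then show "?F n x \<le> ?F (Suc n) x"
        by (intro mult_left_mono) (auto simp: indicator_def simp del: of_nat_Suc)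
    qed
  qed measurable
  also have "\<dots> \<le> ?rhs"
    by (intro SUP_least annulus) simp
  finally show ?thesis .
qed

section \<open>Compactness in the space of square integrable functions\<close>

lemma tendsto_0_if_ennreal_le:
  fixes f :: "'a \<Rightarrow> ennreal"
  assumes "\<And>e. e > 0 \<Longrightarrow> \<forall>\<^sub>F k in F. f k \<le> ennreal e"
  shows "(f \<longlongrightarrow> 0) F"
proof (rule order_tendstoI)
  fix a :: ennreal assume "0 < a"
  then obtain e where e: "0 < ennreal e" "ennreal e < a"
    by (metis dense ennreal_cases less_top_ennreal order_less_trans top.extremum_strict ennreal_less_top not_less_iff_gr_or_eq)
  then have "\<forall>\<^sub>F k in F. f k \<le> ennreal e"
    by (intro assms) simp
  then show "\<forall>\<^sub>F k in F. f k < a"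
    by eventually_elim (use e in order)
qed auto

text \<open>Riesz-Fischer: a subsequence with rapidly decreasing consecutive distances converges
  almost everywhere, and Fatou transfers the Cauchy bound to the limit. The conditions concern
  differences, so the \<open>v k\<close> themselves may have infinite norm.\<close>

lemma L2_complete:
  fixes v :: "nat \<Rightarrow> 'a \<Rightarrow> real"
  assumes [measurable]: "\<And>k. v k \<in> borel_measurable M"
    and Cauchy: "\<And>e. e > 0 \<Longrightarrow> \<exists>K. \<forall>j\<ge>K. \<forall>k\<ge>K. (\<integral>\<^sup>+x. ennreal ((v j x - v k x)\<^sup>2) \<partial>M) \<le> ennreal e"
  obtains w where "w \<in> borel_measurable M" "(\<lambda>k. \<integral>\<^sup>+x. ennreal ((v k x - w x)\<^sup>2) \<partial>M) \<longlonglongrightarrow> 0"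
proof -
  have "\<exists>K. \<forall>n. (\<forall>j\<ge>K n. \<forall>k\<ge>K n. (\<integral>\<^sup>+x. ennreal ((v j x - v k x)\<^sup>2) \<partial>M) \<le> ennreal ((1/4)^n))"
    by (intro choice allI Cauchy) simp
  then obtain K where K: "\<And>n j k. j \<ge> K n \<Longrightarrow> k \<ge> K n \<Longrightarrow>
      (\<integral>\<^sup>+x. ennreal ((v j x - v k x)\<^sup>2) \<partial>M) \<le> ennreal ((1/4)^n)" by blast
  \<comment> \<open>\<open>K\<close> need not be monotone; the partial sum puts both
    \<open>s n\<close> and \<open>s (Suc n)\<close> above \<open>K n\<close>. The summand
    \<open>n\<close> makes \<open>s\<close> pass every bound.\<close>
  define s where "s n = n + (\<Sum>i\<le>n. K i)" for n
  have sK: "s n \<ge> K n" "s (Suc n) \<ge> K n" "s n \<ge> n" for n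
  proof -
    have "K n \<le> (\<Sum>i\<le>n. K i)" by (rule member_le_sum) auto
    then show "s n \<ge> K n" "s (Suc n) \<ge> K n" "s n \<ge> n" by (auto simp: s_def)
  qed
  define d where "d n x = v (s (Suc n)) x - v (s n) x" for n x
  have [measurable]: "d n \<in> borel_measurable M" for n unfolding d_def by measurable
  \<comment> \<open>The factor \<open>2^n\<close> turns integrability of the sum into geometric decay of \<open>d n x\<close>, without any
    assumption that the measure is finite.\<close>
  have "(\<integral>\<^sup>+x. (\<Sum>n. ennreal (2^n * (d n x)\<^sup>2)) \<partial>M) = (\<Sum>n. \<integral>\<^sup>+x. ennreal (2^n * (d n x)\<^sup>2) \<partial>M)"
    by (rule nn_integral_suminf) measurable
  also have "\<dots> \<le> (\<Sum>n. ennreal ((1/2)^n))"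
  proof (intro suminf_le allI)
    fix n
    have "(\<integral>\<^sup>+x. ennreal (2^n * (d n x)\<^sup>2) \<partial>M) = ennreal (2^n) * (\<integral>\<^sup>+x. ennreal ((d n x)\<^sup>2) \<partial>M)"
      by (simp add: ennreal_mult nn_integral_cmult del: ennreal_numeral)
    also have "\<dots> \<le> ennreal (2^n) * ennreal ((1/4)^n)"
      unfolding d_def by (intro mult_left_mono K sK) auto
    also have "\<dots> = ennreal ((1/2)^n)"
      by (simp add: ennreal_mult[symmetric] power_mult_distrib[symmetric])
    finally show "(\<integral>\<^sup>+x. ennreal (2^n * (d n x)\<^sup>2) \<partial>M) \<le> ennreal ((1/2)^n)" .
  qed auto
  also have "\<dots> < \<infinity>"
    by (subst suminf_ennreal2) (auto simp: summable_geometric)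
  finally have "AE x in M. (\<Sum>n. ennreal (2^n * (d n x)\<^sup>2)) \<noteq> \<infinity>"
    by (intro nn_integral_PInf_AE) auto
  then have conv: "AE x in M. convergent (\<lambda>n. v (s n) x)"
  proof eventually_elim
    case (elim x)
    define S where "S = (\<Sum>n. ennreal (2^n * (d n x)\<^sup>2))"
    have "S \<noteq> \<infinity>" using elim unfolding S_def .
    then obtain C where C: "S = ennreal C" "C \<ge> 0"
      by (cases S) auto
    have dn: "norm (d n x) \<le> sqrt C * (sqrt (1/2))^n" for n
    proof -
      have "(\<Sum>i\<in>{n}. ennreal (2^i * (d i x)\<^sup>2)) \<le> S"
        unfolding S_def by (rule sum_le_suminf) auto
      then have "2^n * (d n x)\<^sup>2 \<le> C"
        using C by simp
      then have "(d n x)\<^sup>2 \<le> C * (1/2)^n"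
        by (simp add: field_simps)
      then have "\<bar>d n x\<bar> \<le> sqrt (C * (1/2)^n)"
        using real_sqrt_le_mono by fastforce
      then show ?thesis
        by (simp only: real_sqrt_mult real_sqrt_power real_norm_def)
    qed
    have "summable (\<lambda>n. sqrt C * (sqrt (1/2))^n)"
      by (intro summable_mult summable_geometric) (simp add: real_sqrt_divide)
    then have "summable (\<lambda>n. d n x)"
      by (rule summable_comparison_test'[where N=0]) (rule dn)
    then have "convergent (\<lambda>n. v (s n) x - v (s 0) x)"
      using sum_lessThan_telescope[where f="\<lambda>n. v (s n) x"]
      by (simp add: summable_iff_convergent d_def)
    then show ?case
      by (simp add: convergent_diff_const_right_iff)
  qed
  \<comment> \<open>On the null set where the subsequence diverges, \<open>lim\<close> is an
    unspecified value; \<open>w\<close> is measurable all the same.\<close>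
  define w where "w x = lim (\<lambda>n. v (s n) x)" for x
  have [measurable]: "w \<in> borel_measurable M"
    unfolding w_def by (rule borel_measurable_lim_metric) measurable
  \<comment> \<open>Fatou along \<open>s\<close> with \<open>k\<close> fixed. Since \<open>k\<close>
    ranges over all large indices, the whole sequence converges and not just the
    subsequence.\<close>
  have bound: "(\<integral>\<^sup>+x. ennreal ((v k x - w x)\<^sup>2) \<partial>M) \<le> ennreal e"
    if N: "\<forall>j\<ge>N. \<forall>k\<ge>N. (\<integral>\<^sup>+x. ennreal ((v j x - v k x)\<^sup>2) \<partial>M) \<le> ennreal e" and k: "k \<ge> N" for k N e
  proof -
    have "(\<integral>\<^sup>+x. ennreal ((v k x - w x)\<^sup>2) \<partial>M) = (\<integral>\<^sup>+x. liminf (\<lambda>n. ennreal ((v k x - v (s n) x)\<^sup>2)) \<partial>M)"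
      using conv
    proof (intro nn_integral_cong_AE, eventually_elim)
      case (elim x)
      then have "(\<lambda>n. v (s n) x) \<longlonglongrightarrow> w x"
        by (simp add: w_def convergent_LIMSEQ_iff)
      then have "(\<lambda>n. ennreal ((v k x - v (s n) x)\<^sup>2)) \<longlonglongrightarrow> ennreal ((v k x - w x)\<^sup>2)"
        by (intro tendsto_intros)
      then show ?case
        by (rule lim_imp_Liminf[OF sequentially_bot, symmetric])
    qed
    also have "\<dots> \<le> liminf (\<lambda>n. \<integral>\<^sup>+x. ennreal ((v k x - v (s n) x)\<^sup>2) \<partial>M)"
      by (rule nn_integral_liminf) measurable
    also have "\<dots> \<le> liminf (\<lambda>n. ennreal e)"
    proof (rule Liminf_mono)
      show "\<forall>\<^sub>F n in sequentially. (\<integral>\<^sup>+x. ennreal ((v k x - v (s n) x)\<^sup>2) \<partial>M) \<le> ennreal e"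
        using eventually_ge_at_top[of N]
      proof eventually_elim
        case (elim n)
        then have "s n \<ge> N" using sK(3)[of n] by linarith
        then show ?case using N k by blast
      qed
    qed
    also have "\<dots> = ennreal e" by (simp add: Liminf_const)
    finally show ?thesis .
  qed
  have "(\<lambda>k. \<integral>\<^sup>+x. ennreal ((v k x - w x)\<^sup>2) \<partial>M) \<longlonglongrightarrow> 0"
  proof (rule tendsto_0_if_ennreal_le)
    fix e :: real assume "e > 0"
    then obtain N where "\<forall>j\<ge>N. \<forall>k\<ge>N. (\<integral>\<^sup>+x. ennreal ((v j x - v k x)\<^sup>2) \<partial>M) \<le> ennreal e"
      using Cauchy by blast
    then show "\<forall>\<^sub>F k in sequentially. (\<integral>\<^sup>+x. ennreal ((v k x - w x)\<^sup>2) \<partial>M) \<le> ennreal e"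
      using eventually_ge_at_top[of N] by (elim eventually_mono) (rule bound)
  qed
  with that \<open>w \<in> borel_measurable M\<close> show thesis by blast
qed

section \<open>Averages over a cubical grid\<close>

text \<open>For \<open>m > 0\<close> this is the half-open grid cube of side 1/m that contains
  \<open>x\<close>. Equality of floors makes the cells of one grid a partition and keeps membership
  measurable in both points jointly. For \<open>m = 0\<close> the cell is the whole space.\<close>

definition cell :: "nat \<Rightarrow> 'a::euclidean_space \<Rightarrow> 'a set" where
  "cell m x = {y. \<forall>i\<in>Basis. \<lfloor>real m * (y \<bullet> i)\<rfloor> = \<lfloor>real m * (x \<bullet> i)\<rfloor>}"

text \<open>A cell is determined by finitely many integers. Countability later allows one diagonal
  subsequence for all cells of all grids.\<close>

lemma countable_range_cell: "countable (range (cell m :: 'a::euclidean_space \<Rightarrow> 'a set))"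
proof (rule countable_subset)
  let ?F = "\<lambda>f. {y::'a. \<forall>i\<in>Basis. \<lfloor>real m * (y \<bullet> i)\<rfloor> = f i}"
  show "range (cell m :: 'a \<Rightarrow> 'a set) \<subseteq> ?F ` (\<Pi>\<^sub>E i\<in>Basis. UNIV)"
  proof safe
    fix x :: 'a
    have "cell m x = ?F (restrict (\<lambda>i. \<lfloor>real m * (x \<bullet> i)\<rfloor>) Basis)"
      by (auto simp: cell_def)
    then show "cell m x \<in> ?F ` (\<Pi>\<^sub>E i\<in>Basis. UNIV)"
      by (simp only:) (intro imageI, auto)
  qed
  show "countable (?F ` (\<Pi>\<^sub>E i\<in>Basis. UNIV :: int set))"
    by (intro countable_image countable_PiE) auto
qed

lemma pred_cell [measurable]: "Measurable.pred (borel \<Otimes>\<^sub>M borel) (\<lambda>(x::'a::euclidean_space, y). y \<in> cell m x)"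
  unfolding cell_def mem_Collect_eq by measurable

lemma sets_cell [measurable]: "cell m x \<in> sets borel"
  unfolding cell_def by measurable

lemma cell_coord_diff:
  assumes y: "y \<in> cell m x" and m: "m > 0" and i: "i \<in> Basis"
  shows "\<bar>(y - x) \<bullet> i\<bar> \<le> 1 / real m"
proof -
  have "\<lfloor>real m * (y \<bullet> i)\<rfloor> = \<lfloor>real m * (x \<bullet> i)\<rfloor>" using y i by (simp add: cell_def)
  then have "\<bar>real m * (y \<bullet> i) - real m * (x \<bullet> i)\<bar> \<le> 1" by linarith
  also have "real m * (y \<bullet> i) - real m * (x \<bullet> i) = real m * ((y - x) \<bullet> i)"
    by (simp add: algebra_simps)
  finally show ?thesis using m by (simp add: abs_mult field_simps)
qed

text \<open>The half-open cube lies between the open and the closed box with the same corners, which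
  have equal volume.\<close>

lemma emeasure_cell:
  fixes x :: "'a::euclidean_space"
  assumes m: "m > 0"
  shows "emeasure lborel (cell m x) = ennreal ((1 / real m) ^ DIM('a))"
proof (rule antisym)
  define a where "a = (\<Sum>i\<in>Basis. (of_int \<lfloor>real m * (x \<bullet> i)\<rfloor> / real m) *\<^sub>R i)"
  define b where "b = (\<Sum>i\<in>Basis. ((of_int \<lfloor>real m * (x \<bullet> i)\<rfloor> + 1) / real m) *\<^sub>R i)"
  have ab: "a \<bullet> i = of_int \<lfloor>real m * (x \<bullet> i)\<rfloor> / real m"
     "b \<bullet> i = (of_int \<lfloor>real m * (x \<bullet> i)\<rfloor> + 1) / real m" if "i \<in> Basis" for i
    using that by (auto simp: a_def b_def)
  have diff: "(b - a) \<bullet> i = 1 / real m" if "i \<in> Basis" for i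
    using ab[OF that] m by (simp add: inner_diff_left field_simps)
  have le: "a \<bullet> i \<le> b \<bullet> i" if "i \<in> Basis" for i
    using diff[OF that] m by (simp add: inner_diff_left) (smt (verit) divide_nonneg_nonneg of_nat_0_le_iff)
  have prod: "(\<Prod>i\<in>Basis. (b - a) \<bullet> i) = (1 / real m) ^ DIM('a)"
    using diff by simp
  have "cell m x \<subseteq> cbox a b"
  proof
    fix y assume y: "y \<in> cell m x"
    show "y \<in> cbox a b"
      unfolding mem_box
    proof (intro ballI)
      fix i :: 'a assume i: "i \<in> Basis"
      have "\<lfloor>real m * (y \<bullet> i)\<rfloor> = \<lfloor>real m * (x \<bullet> i)\<rfloor>" using y i by (simp add: cell_def)
      then have "of_int \<lfloor>real m * (x \<bullet> i)\<rfloor> \<le> real m * (y \<bullet> i)"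
        "real m * (y \<bullet> i) \<le> of_int \<lfloor>real m * (x \<bullet> i)\<rfloor> + 1" by linarith+
      then show "a \<bullet> i \<le> y \<bullet> i \<and> y \<bullet> i \<le> b \<bullet> i"
        using ab[OF i] m by (simp add: divide_le_eq le_divide_eq mult.commute)
    qed
  qed
  then have "emeasure lborel (cell m x) \<le> emeasure lborel (cbox a b)"
    by (rule emeasure_mono) simp
  then show "emeasure lborel (cell m x) \<le> ennreal ((1 / real m) ^ DIM('a))"
    using le prod by (simp add: emeasure_lborel_cbox)
  have "box a b \<subseteq> cell m x"
  proof
    fix y assume y: "y \<in> box a b"
    show "y \<in> cell m x"
      unfolding cell_def mem_Collect_eq
    proof
      fix i :: 'a assume i: "i \<in> Basis"
      then have "of_int \<lfloor>real m * (x \<bullet> i)\<rfloor> < real m * (y \<bullet> i)"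
        "real m * (y \<bullet> i) < of_int \<lfloor>real m * (x \<bullet> i)\<rfloor> + 1"
        using y ab[OF i] m by (auto simp: mem_box divide_less_eq less_divide_eq mult.commute)
      then show "\<lfloor>real m * (y \<bullet> i)\<rfloor> = \<lfloor>real m * (x \<bullet> i)\<rfloor>" by linarith
    qed
  qed
  then have "emeasure lborel (box a b) \<le> emeasure lborel (cell m x)"
    by (rule emeasure_mono) simp
  then show "ennreal ((1 / real m) ^ DIM('a)) \<le> emeasure lborel (cell m x)"
    using le prod by (simp add: emeasure_lborel_box)
qed

definition cell_average :: "nat \<Rightarrow> ('a::euclidean_space \<Rightarrow> real) \<Rightarrow> 'a \<Rightarrow> real" where
  "cell_average m u x = real m ^ DIM('a) * (LINT y|lborel. indicator (cell m x) y * u y)"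

lemma borel_measurable_cell_average [measurable]:
  assumes [measurable]: "u \<in> borel_measurable borel"
  shows "cell_average m u \<in> borel_measurable borel"
proof -
  have "(\<lambda>(x, y). indicator (cell m x) y * u y) =
     (\<lambda>p. indicator {p. (\<lambda>(x, y). y \<in> cell m x) p} p * u (snd p))"
    by (auto simp: indicator_def fun_eq_iff)
  also have "\<dots> \<in> borel_measurable (borel \<Otimes>\<^sub>M lborel)" by measurable
  finally show ?thesis
    unfolding cell_average_def by measurable
qed

text \<open>Jensen's inequality on the cell: the difference is the mean of u(x) - u(y) over the
  cell, and the square of a mean is at most the mean of the squares. The factor
  \<open>real m ^ DIM('a)\<close> is the reciprocal of the volume of the cell.\<close>

lemma cell_average_pointwise:
  fixes u :: "'a::euclidean_space \<Rightarrow> real"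
  assumes int: "integrable lborel u" and m: "m > 0"
  shows "ennreal ((u x - cell_average m u x)\<^sup>2) \<le> ennreal (real m ^ DIM('a)) *
    (\<integral>\<^sup>+y. ennreal ((u y - u x)\<^sup>2) * indicator (cell m x) y \<partial>lborel)"
proof -
  have [measurable]: "u \<in> borel_measurable borel" using int by auto
  let ?N = "real m ^ DIM('a)"
  have N: "?N * (1 / real m) ^ DIM('a) = 1" using m by (simp add: power_one_over)
  have fin: "emeasure lborel (cell m x) < \<infinity>" using emeasure_cell[OF m, of x] by simp
  have meas: "measure lborel (cell m x) = (1 / real m) ^ DIM('a)"
    using emeasure_cell[OF m, of x] by (simp add: measure_def)
  have i1: "integrable lborel (\<lambda>y. indicator (cell m x) y * u x)"
    using fin by (intro integrable_mult_left integrable_real_indicator) auto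
  have i2: "integrable lborel (\<lambda>y. indicator (cell m x) y * u y)"
    using integrable_mult_indicator[OF _ int, of "cell m x"] by simp
  have "u x - cell_average m u x = ?N * ((LINT y|lborel. indicator (cell m x) y * u x) -
     (LINT y|lborel. indicator (cell m x) y * u y))"
    using N by (simp add: cell_average_def meas right_diff_distrib mult.assoc[symmetric])
  also have "\<dots> = ?N * (LINT y|lborel. indicator (cell m x) y * (u x - u y))"
    using i1 i2 by (subst Bochner_Integration.integral_diff[symmetric]) (auto simp: right_diff_distrib)
  finally have eq: "u x - cell_average m u x = ?N * (LINT y|lborel. indicator (cell m x) y * (u x - u y))" .
  have "integrable lborel (\<lambda>y. indicator (cell m x) y * (u x - u y))"
    using Bochner_Integration.integrable_diff[OF i1 i2] by (simp add: right_diff_distrib)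
  then have "ennreal \<bar>LINT y|lborel. indicator (cell m x) y * (u x - u y)\<bar> \<le>
      (\<integral>\<^sup>+y. ennreal (norm (indicator (cell m x) y * (u x - u y))) \<partial>lborel)"
    using integral_norm_bound_ennreal by fastforce
  \<comment> \<open>Writing the indicator twice lets Cauchy-Schwarz split off the volume of the cell
    as the second factor.\<close>
  also have "\<dots> = (\<integral>\<^sup>+y. (ennreal \<bar>u y - u x\<bar> * indicator (cell m x) y) * indicator (cell m x) y \<partial>lborel)"
    by (intro nn_integral_cong) (auto simp: indicator_def abs_minus_commute)
  finally have "(ennreal \<bar>LINT y|lborel. indicator (cell m x) y * (u x - u y)\<bar>)\<^sup>2 \<le>
      (\<integral>\<^sup>+y. (ennreal \<bar>u y - u x\<bar> * indicator (cell m x) y) * indicator (cell m x) y \<partial>lborel)\<^sup>2"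
    by (intro power_mono) auto
  also have "\<dots> \<le> (\<integral>\<^sup>+y. (ennreal \<bar>u y - u x\<bar> * indicator (cell m x) y)\<^sup>2 \<partial>lborel) *
      (\<integral>\<^sup>+y. (indicator (cell m x) y)\<^sup>2 \<partial>lborel)"
    by (rule Cauchy_Schwarz_nn_integral) measurable
  also have "(\<integral>\<^sup>+y. (ennreal \<bar>u y - u x\<bar> * indicator (cell m x) y)\<^sup>2 \<partial>lborel) =
      (\<integral>\<^sup>+y. ennreal ((u y - u x)\<^sup>2) * indicator (cell m x) y \<partial>lborel)"
    by (intro nn_integral_cong) (auto simp: indicator_def ennreal_power)
  also have "(\<integral>\<^sup>+y. (indicator (cell m x) y)\<^sup>2 \<partial>lborel) = (\<integral>\<^sup>+y. indicator (cell m x) y \<partial>lborel)"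
    by (intro nn_integral_cong) (auto simp: indicator_def)
  also have "\<dots> = ennreal ((1 / real m) ^ DIM('a))"
    using emeasure_cell[OF m, of x] by simp
  finally have 1: "(ennreal \<bar>LINT y|lborel. indicator (cell m x) y * (u x - u y)\<bar>)\<^sup>2 \<le>
      (\<integral>\<^sup>+y. ennreal ((u y - u x)\<^sup>2) * indicator (cell m x) y \<partial>lborel) * ennreal ((1 / real m) ^ DIM('a))" .
  have "ennreal ((u x - cell_average m u x)\<^sup>2) =
      ennreal (?N\<^sup>2) * (ennreal \<bar>LINT y|lborel. indicator (cell m x) y * (u x - u y)\<bar>)\<^sup>2"
    unfolding eq by (simp add: ennreal_power ennreal_mult[symmetric] power_mult_distrib)
  also have "\<dots> \<le> ennreal (?N\<^sup>2) * ((\<integral>\<^sup>+y. ennreal ((u y - u x)\<^sup>2) * indicator (cell m x) y \<partial>lborel) *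
      ennreal ((1 / real m) ^ DIM('a)))"
    by (intro mult_left_mono 1) auto
  also have "\<dots> = ennreal (?N * (?N * (1 / real m) ^ DIM('a))) *
      (\<integral>\<^sup>+y. ennreal ((u y - u x)\<^sup>2) * indicator (cell m x) y \<partial>lborel)"
    by (simp add: ennreal_mult power2_eq_square mult_ac)
  finally show ?thesis unfolding N by simp
qed

text \<open>The cell depends on the position of \<open>x\<close> in the grid, so it is enlarged to
  the cube \<open>x + Q\<close> of side 2/m centred at \<open>x\<close>. The average is then over
  translations \<open>h\<close> from a fixed set, and Fubini allows \<open>equi\<close> to be
  applied for each \<open>h\<close>. The constant is the ratio of the volumes of \<open>Q\<close>
  and a cell; the radius in \<open>equi\<close> bounds the sum of the coordinates of
  \<open>h\<close> in modulus.\<close>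

lemma cell_average_estimate:
  fixes u :: "'a::euclidean_space \<Rightarrow> real"
  assumes int: "integrable lborel u" and m: "m > 0" and [measurable]: "D \<in> sets borel"
    and equi: "\<And>h. norm h \<le> real DIM('a) / real m \<Longrightarrow>
      (\<integral>\<^sup>+x. ennreal ((u (h + x) - u x)\<^sup>2) * indicator D x \<partial>lborel) \<le> e"
  shows "(\<integral>\<^sup>+x. ennreal ((u x - cell_average m u x)\<^sup>2) * indicator D x \<partial>lborel) \<le> ennreal (2 ^ DIM('a)) * e"
proof -
  have [measurable]: "u \<in> borel_measurable borel" using int by auto
  let ?N = "real m ^ DIM('a)"
  define c :: 'a where "c = (\<Sum>i\<in>Basis. (1 / real m) *\<^sub>R i)"
  have c: "c \<bullet> i = 1 / real m" if "i \<in> Basis" for i using that by (simp add: c_def)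
  define Q where "Q = cbox (- c) c"
  have Q_iff: "h \<in> Q \<longleftrightarrow> (\<forall>i\<in>Basis. \<bar>h \<bullet> i\<bar> \<le> 1 / real m)" for h
    by (auto simp: Q_def mem_box c abs_le_iff minus_le_iff)
  have [measurable]: "Q \<in> sets borel" by (simp add: Q_def)
  have mQ: "emeasure lborel Q = ennreal ((2 / real m) ^ DIM('a))"
  proof -
    have "(\<Prod>i\<in>Basis. (c - - c) \<bullet> i) = (\<Prod>i\<in>(Basis::'a set). 2 / real m)"
      by (intro prod.cong) (auto simp: c inner_add_left)
    then show ?thesis
      unfolding Q_def by (subst emeasure_lborel_cbox) (auto simp: c)
  qed
  have nQ: "norm h \<le> real DIM('a) / real m" if "h \<in> Q" for h
  proof -
    have "norm h \<le> (\<Sum>i\<in>Basis. \<bar>h \<bullet> i\<bar>)" by (rule norm_le_l1)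
    also have "\<dots> \<le> (\<Sum>i\<in>(Basis::'a set). 1 / real m)"
      using that by (intro sum_mono) (simp add: Q_iff)
    finally show ?thesis by simp
  qed
  have cQ: "indicator (cell m x) y \<le> (indicator Q (y - x) :: ennreal)" for x y :: 'a
    using cell_coord_diff[of y m x] m by (simp add: indicator_def Q_iff)
  have "(\<integral>\<^sup>+x. ennreal ((u x - cell_average m u x)\<^sup>2) * indicator D x \<partial>lborel) \<le>
    (\<integral>\<^sup>+x. (\<integral>\<^sup>+h. ennreal ?N * (indicator Q h * (ennreal ((u (h + x) - u x)\<^sup>2) * indicator D x)) \<partial>lborel) \<partial>lborel)"
  proof (rule nn_integral_mono)
    fix x
    have "ennreal ((u x - cell_average m u x)\<^sup>2) * indicator D x \<le>
      ennreal ?N * (\<integral>\<^sup>+y. ennreal ((u y - u x)\<^sup>2) * indicator (cell m x) y \<partial>lborel) * indicator D x"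
      by (intro mult_right_mono cell_average_pointwise int m) auto
    also have "\<dots> \<le> ennreal ?N * (\<integral>\<^sup>+y. ennreal ((u y - u x)\<^sup>2) * indicator Q (y - x) \<partial>lborel) * indicator D x"
      by (intro mult_right_mono mult_left_mono nn_integral_mono cQ) auto
    also have "(\<integral>\<^sup>+y. ennreal ((u y - u x)\<^sup>2) * indicator Q (y - x) \<partial>lborel) =
       (\<integral>\<^sup>+h. ennreal ((u (h + x) - u x)\<^sup>2) * indicator Q h \<partial>lborel)"
      using nn_integral_lborel_affine[of "\<lambda>y. ennreal ((u y - u x)\<^sup>2) * indicator Q (y - x)" 1 x]
      by (simp add: add.commute)
    also have "ennreal ?N * (\<integral>\<^sup>+h. ennreal ((u (h + x) - u x)\<^sup>2) * indicator Q h \<partial>lborel) * indicator D x =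
      (\<integral>\<^sup>+h. ennreal ?N * (indicator Q h * (ennreal ((u (h + x) - u x)\<^sup>2) * indicator D x)) \<partial>lborel)"
      by (subst nn_integral_cmult[symmetric], measurable, subst nn_integral_multc[symmetric], measurable)
        (simp add: mult_ac)
    finally show "ennreal ((u x - cell_average m u x)\<^sup>2) * indicator D x \<le>
      (\<integral>\<^sup>+h. ennreal ?N * (indicator Q h * (ennreal ((u (h + x) - u x)\<^sup>2) * indicator D x)) \<partial>lborel)" .
  qed
  also have "\<dots> = (\<integral>\<^sup>+h. (\<integral>\<^sup>+x. ennreal ?N * (indicator Q h *
      (ennreal ((u (h + x) - u x)\<^sup>2) * indicator D x)) \<partial>lborel) \<partial>lborel)"
    by (rule lborel_pair.Fubini') measurable
  also have "\<dots> \<le> (\<integral>\<^sup>+h. (ennreal ?N * e) * indicator Q h \<partial>lborel)"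
  proof (rule nn_integral_mono)
    fix h
    have "(\<integral>\<^sup>+x. ennreal ?N * (indicator Q h * (ennreal ((u (h + x) - u x)\<^sup>2) * indicator D x)) \<partial>lborel) =
      ennreal ?N * (indicator Q h * (\<integral>\<^sup>+x. ennreal ((u (h + x) - u x)\<^sup>2) * indicator D x \<partial>lborel))"
      by (subst nn_integral_cmult, measurable, subst nn_integral_cmult) auto
    also have "\<dots> \<le> (ennreal ?N * e) * indicator Q h"
      using equi[of h] nQ[of h] by (auto simp: indicator_def intro: mult_left_mono)
    finally show "(\<integral>\<^sup>+x. ennreal ?N * (indicator Q h * (ennreal ((u (h + x) - u x)\<^sup>2) * indicator D x)) \<partial>lborel)
      \<le> (ennreal ?N * e) * indicator Q h" .
  qed
  also have "\<dots> = ennreal (?N * (2 / real m) ^ DIM('a)) * e"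
    by (subst nn_integral_cmult_indicator) (auto simp: mQ ennreal_mult mult_ac)
  also have "?N * (2 / real m) ^ DIM('a) = 2 ^ DIM('a)"
    using m by (simp add: power_divide)
  finally show ?thesis .
qed

section \<open>The Kolmogorov-Riesz criterion\<close>

text \<open>Equicontinuity is required on a set \<open>D\<close> that may depend on
  \<open>e\<close>, with little mass outside \<open>D\<close>; this suits a weight that degenerates
  at one point. On \<open>D\<close> the functions are close to their averages over a fine grid,
  uniformly in \<open>k\<close>, and along a diagonal subsequence the averages on every grid
  converge. The subsequence is therefore Cauchy in L^2.\<close>

lemma Kolmogorov_Riesz_L2:
  fixes u :: "nat \<Rightarrow> 'a::euclidean_space \<Rightarrow> real"
  assumes [measurable]: "\<And>k. u k \<in> borel_measurable borel"
    and supp: "\<And>k x. R \<le> norm x \<Longrightarrow> u k x = 0"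
    and bound: "\<And>k. (\<integral>\<^sup>+x. ennreal ((u k x)\<^sup>2) \<partial>lborel) \<le> ennreal C"
    and equi: "\<And>e. e > 0 \<Longrightarrow> \<exists>D\<in>sets borel. \<exists>\<delta>>0. \<forall>k.
      (\<integral>\<^sup>+x. ennreal ((u k x)\<^sup>2) * indicator (- D) x \<partial>lborel) \<le> ennreal e \<and>
      (\<forall>h. norm h \<le> \<delta> \<longrightarrow>
        (\<integral>\<^sup>+x. ennreal ((u k (h + x) - u k x)\<^sup>2) * indicator D x \<partial>lborel) \<le> ennreal e)"
  obtains r :: "nat \<Rightarrow> nat" and w where "strict_mono r" "w \<in> borel_measurable borel"
    "(\<lambda>k. \<integral>\<^sup>+x. ennreal ((u (r k) x - w x)\<^sup>2) \<partial>lborel) \<longlonglongrightarrow> 0"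
proof -
  define B where "B = ball (0::'a) R"
  have [measurable]: "B \<in> sets borel" by (simp add: B_def)
  have Bfin: "emeasure lborel B < \<infinity>" unfolding B_def by (rule emeasure_bounded_finite) simp
  have off: "u k x = 0" if "x \<notin> B" for k x using supp that by (simp add: B_def)
  \<comment> \<open>An L^1 bound, from |t| \<le> 1 + t^2 on \<open>B\<close>. The modulus of
    \<open>C\<close> makes \<open>M\<close> nonnegative whatever the sign of
    \<open>C\<close>.\<close>
  define M where "M = measure lborel B + \<bar>C\<bar>"
  have M0: "M \<ge> 0" by (simp add: M_def)
  have L1: "(\<integral>\<^sup>+x. ennreal (norm (u k x)) \<partial>lborel) \<le> ennreal M" for k
  proof -
    have "(\<integral>\<^sup>+x. ennreal (norm (u k x)) \<partial>lborel) \<le> (\<integral>\<^sup>+x. indicator B x + ennreal ((u k x)\<^sup>2) \<partial>lborel)"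
    proof (rule nn_integral_mono)
      fix x
      have "\<bar>u k x\<bar> \<le> 1 + (u k x)\<^sup>2"
        using zero_le_power2[of "\<bar>u k x\<bar> - 1"] by (simp add: power2_diff)
      then show "ennreal (norm (u k x)) \<le> indicator B x + ennreal ((u k x)\<^sup>2)"
        using off[of x k] by (cases "x \<in> B") (auto simp: ennreal_plus[symmetric] ennreal_1[symmetric]
            simp del: ennreal_plus ennreal_1 intro!: ennreal_leI)
    qed
    also have "\<dots> = emeasure lborel B + (\<integral>\<^sup>+x. ennreal ((u k x)\<^sup>2) \<partial>lborel)"
      by (subst nn_integral_add) auto
    also have "\<dots> \<le> ennreal (measure lborel B) + ennreal \<bar>C\<bar>"
      using Bfin bound[of k] by (intro add_mono) (auto simp: emeasure_eq_ennreal_measure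
          intro: order_trans ennreal_leI)
    finally show ?thesis by (simp add: M_def)
  qed
  have int: "integrable lborel (u k)" for k
    using L1[of k] by (intro integrableI_bounded) (auto intro: le_less_trans)
  have Qb: "norm (LINT y|lborel. indicator Q y * u k y) \<le> M" if "Q \<in> sets borel" for Q k
  proof -
    have "integrable lborel (\<lambda>y. indicator Q y * u k y)"
      using integrable_mult_indicator[OF _ int, of Q] that by simp
    then have "ennreal (norm (LINT y|lborel. indicator Q y * u k y)) \<le>
        (\<integral>\<^sup>+y. ennreal (norm (indicator Q y * u k y)) \<partial>lborel)"
      by (rule integral_norm_bound_ennreal)
    also have "\<dots> \<le> (\<integral>\<^sup>+y. ennreal (norm (u k y)) \<partial>lborel)"
      by (intro nn_integral_mono) (auto simp: indicator_def)
    also have "\<dots> \<le> ennreal M" by (rule L1)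
    finally show ?thesis using M0 by simp
  qed
  define \<Q> where "\<Q> = (\<Union>m. range (cell m :: 'a \<Rightarrow> 'a set))"
  have countable: "countable \<Q>"
    unfolding \<Q>_def by (intro countable_UN countable_range_cell) auto
  have "norm (LINT y|lborel. indicator Q y * u k y) \<le> M" if "Q \<in> \<Q>" for Q k
    using that by (intro Qb) (auto simp: \<Q>_def)
  \<comment> \<open>Diagonal extraction: the integrals are regarded as bounded functions of
    \<open>Q\<close> on the countable set of cells. The subsequence is fixed before any grid size is
    chosen.\<close>
  from function_convergent_subsequence[where f="\<lambda>k Q. LINT y|lborel. indicator Q y * u k y", OF countable this]
  obtain r where r: "strict_mono (r::nat\<Rightarrow>nat)"
    and rl: "\<And>Q. Q \<in> \<Q> \<Longrightarrow> \<exists>l. (\<lambda>k. LINT y|lborel. indicator Q y * u (r k) y) \<longlonglongrightarrow> l"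
    by auto
  define v where "v k = u (r k)" for k
  have [measurable]: "v k \<in> borel_measurable borel" for k by (simp add: v_def)
  define A where "A m k = cell_average m (v k)" for m k
  have [measurable]: "A m k \<in> borel_measurable borel" for m k by (simp add: A_def)
  define L where "L m x = lim (\<lambda>k. A m k x)" for m x
  have [measurable]: "L m \<in> borel_measurable borel" for m
    unfolding L_def by (rule borel_measurable_lim_metric) measurable
  have AL: "(\<lambda>k. A m k x) \<longlonglongrightarrow> L m x" for m x
  proof -
    obtain l where "(\<lambda>k. LINT y|lborel. indicator (cell m x) y * v k y) \<longlonglongrightarrow> l"
      using rl[of "cell m x"] by (auto simp: \<Q>_def v_def)
    then have "(\<lambda>k. A m k x) \<longlonglongrightarrow> real m ^ DIM('a) * l"
      unfolding A_def cell_average_def by (intro tendsto_intros)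
    then have "convergent (\<lambda>k. A m k x)" by (rule convergentI)
    then show ?thesis by (simp add: L_def convergent_LIMSEQ_iff)
  qed
  have Ab: "\<bar>A m k x\<bar> \<le> real m ^ DIM('a) * M" for m k x
    using Qb[of "cell m x" "r k"] by (simp add: A_def cell_average_def v_def abs_mult mult_left_mono)
  have Lb: "\<bar>L m x\<bar> \<le> real m ^ DIM('a) * M" for m x
    by (rule LIMSEQ_le_const2[OF tendsto_rabs[OF AL]]) (use Ab in blast)
  \<comment> \<open>On the set \<open>B\<close> of finite measure the averages for fixed
    \<open>m\<close> are uniformly bounded, so dominated convergence turns pointwise convergence
    into L^2 convergence.\<close>
  have ALint: "(\<lambda>k. \<integral>\<^sup>+x. ennreal ((A m k x - L m x)\<^sup>2) * indicator B x \<partial>lborel) \<longlonglongrightarrow> 0" for m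
  proof -
    define K where "K = (2 * (real m ^ DIM('a) * M))\<^sup>2"
    have "(\<lambda>k. \<integral>\<^sup>+x. ennreal ((A m k x - L m x)\<^sup>2) * indicator B x \<partial>lborel) \<longlonglongrightarrow> (\<integral>\<^sup>+x. 0 \<partial>(lborel::'a measure))"
    proof (rule nn_integral_dominated_convergence[where w="\<lambda>x. ennreal K * indicator B x"])
      show "AE x in lborel. ennreal ((A m k x - L m x)\<^sup>2) * indicator B x \<le> ennreal K * indicator B x" for k
      proof (rule AE_I2)
        fix x
        have "\<bar>A m k x - L m x\<bar> \<le> 2 * (real m ^ DIM('a) * M)"
          using Ab[of m k x] Lb[of m x] by linarith
        then have "(A m k x - L m x)\<^sup>2 \<le> K"
          unfolding K_def by (metis abs_ge_zero power2_abs power_mono)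
        then show "ennreal ((A m k x - L m x)\<^sup>2) * indicator B x \<le> ennreal K * indicator B x"
          by (intro mult_right_mono ennreal_leI) auto
      qed
      show "(\<integral>\<^sup>+x. ennreal K * indicator B x \<partial>lborel) < \<infinity>"
        using Bfin by (simp add: nn_integral_cmult_indicator ennreal_mult_less_top)
      show "AE x in lborel. (\<lambda>k. ennreal ((A m k x - L m x)\<^sup>2) * indicator B x) \<longlonglongrightarrow> 0"
      proof (rule AE_I2)
        fix x
        have "(\<lambda>k. ennreal ((A m k x - L m x)\<^sup>2)) \<longlonglongrightarrow> ennreal ((L m x - L m x)\<^sup>2)"
          by (intro tendsto_intros AL)
        then show "(\<lambda>k. ennreal ((A m k x - L m x)\<^sup>2) * indicator B x) \<longlonglongrightarrow> 0"
          by (cases "x \<in> B") auto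
      qed
    qed measurable
    then show ?thesis by simp
  qed
  have Cauchy: "\<exists>K. \<forall>j\<ge>K. \<forall>k\<ge>K. (\<integral>\<^sup>+x. ennreal ((v j x - v k x)\<^sup>2) \<partial>lborel) \<le> ennreal e" if e: "e > 0" for e
  proof -
    \<comment> \<open>The factor 4 comes from \<open>pt\<close>, and \<open>Fint\<close> contributes
      \<open>2 + 2 ^ DIM('a)\<close> for each of \<open>j\<close> and \<open>k\<close>.\<close>
    define e' where "e' = e / (4 * (4 + 2 * 2 ^ DIM('a)))"
    have e': "e' > 0" using e by (simp add: e'_def add_pos_pos)
    obtain D \<delta> where [measurable]: "D \<in> sets borel" and \<delta>: "\<delta> > 0"
      and D1: "\<And>k. (\<integral>\<^sup>+x. ennreal ((u k x)\<^sup>2) * indicator (- D) x \<partial>lborel) \<le> ennreal e'"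
      and D2: "\<And>k h. norm h \<le> \<delta> \<Longrightarrow>
        (\<integral>\<^sup>+x. ennreal ((u k (h + x) - u k x)\<^sup>2) * indicator D x \<partial>lborel) \<le> ennreal e'"
      using equi[OF e'] by blast
    obtain n :: nat where n: "real DIM('a) / \<delta> < real n" using reals_Archimedean2 by blast
    define m where "m = Suc n"
    have "real DIM('a) < \<delta> * real m"
      using n \<delta> by (simp add: m_def divide_less_eq algebra_simps)
    then have m: "m > 0" "real DIM('a) / real m \<le> \<delta>"
      by (auto simp: m_def divide_le_eq)
    have P: "(\<integral>\<^sup>+x. ennreal ((v k x - A m k x)\<^sup>2) * indicator D x \<partial>lborel) \<le> ennreal (2 ^ DIM('a) * e')" for k
    proof -
      have "(\<integral>\<^sup>+x. ennreal ((v k x - A m k x)\<^sup>2) * indicator D x \<partial>lborel) \<le> ennreal (2 ^ DIM('a)) * ennreal e'"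
        unfolding A_def v_def using m D2 by (intro cell_average_estimate int) auto
      then show ?thesis by (simp add: ennreal_mult e' less_imp_le)
    qed
    have "\<forall>\<^sub>F k in sequentially. (\<integral>\<^sup>+x. ennreal ((A m k x - L m x)\<^sup>2) * indicator B x \<partial>lborel) < ennreal e'"
      using ALint[of m] e' by (intro order_tendstoD(2)[where y=0]) auto
    then obtain K where K: "\<And>k. k \<ge> K \<Longrightarrow>
        (\<integral>\<^sup>+x. ennreal ((A m k x - L m x)\<^sup>2) * indicator B x \<partial>lborel) < ennreal e'"
      by (auto simp: eventually_sequentially)
    have "(\<integral>\<^sup>+x. ennreal ((v j x - v k x)\<^sup>2) \<partial>lborel) \<le> ennreal e" if j: "j \<ge> K" and k: "k \<ge> K" for j k
    proof -
      define F where "F i x = (v i x)\<^sup>2 * indicator (- D) x + (v i x - A m i x)\<^sup>2 * indicator D x +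
        (A m i x - L m x)\<^sup>2 * indicator B x" for i x
      have F0: "F i x \<ge> 0" for i x by (simp add: F_def)
      have [measurable]: "F i \<in> borel_measurable borel" for i unfolding F_def by measurable
      have Fint: "(\<integral>\<^sup>+x. ennreal (F i x) \<partial>lborel) \<le> ennreal (e' + 2 ^ DIM('a) * e' + e')" if "i \<ge> K" for i
      proof -
        have "(\<integral>\<^sup>+x. ennreal (F i x) \<partial>lborel) = (\<integral>\<^sup>+x. ennreal ((v i x)\<^sup>2) * indicator (- D) x +
            ennreal ((v i x - A m i x)\<^sup>2) * indicator D x + ennreal ((A m i x - L m x)\<^sup>2) * indicator B x \<partial>lborel)"
          unfolding F_def by (intro nn_integral_cong) (auto simp: indicator_def)
        also have "\<dots> = (\<integral>\<^sup>+x. ennreal ((v i x)\<^sup>2) * indicator (- D) x \<partial>lborel) +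
            (\<integral>\<^sup>+x. ennreal ((v i x - A m i x)\<^sup>2) * indicator D x \<partial>lborel) +
            (\<integral>\<^sup>+x. ennreal ((A m i x - L m x)\<^sup>2) * indicator B x \<partial>lborel)"
          by (simp add: nn_integral_add)
        also have "\<dots> \<le> ennreal e' + ennreal (2 ^ DIM('a) * e') + ennreal e'"
          using D1[of "r i"] P[of i] K[OF that] by (intro add_mono) (auto simp: v_def)
        also have "\<dots> = ennreal (e' + 2 ^ DIM('a) * e' + e')"
          using e' by (simp only: ennreal_plus add_nonneg_nonneg mult_nonneg_nonneg less_imp_le zero_le_power zero_le_numeral)
        finally show ?thesis .
      qed
      \<comment> \<open>On \<open>B\<close> inside \<open>D\<close> both functions are compared with
        the common limit \<open>L m\<close> through their averages; on \<open>B\<close> outside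
        \<open>D\<close> each is estimated by its own size; off \<open>B\<close> both
        vanish.\<close>
      have pt: "(v j x - v k x)\<^sup>2 \<le> 4 * (F j x + F k x)" for x
      proof (cases "x \<in> B")
        case True
        have sq: "(p + q)\<^sup>2 \<le> 2 * (p\<^sup>2 + q\<^sup>2)" for p q :: real
          using zero_le_power2[of "p - q"] by (simp add: power2_eq_square algebra_simps)
        show ?thesis
        proof (cases "x \<in> D")
          case D: True
          have s: "(v i x - L m x)\<^sup>2 \<le> 2 * F i x" for i
            using sq[of "v i x - A m i x" "A m i x - L m x"] True D by (simp add: F_def)
          show ?thesis
            using sq[of "v j x - L m x" "L m x - v k x"] s[of j] s[of k]
            by (simp add: power2_commute[of "L m x" "v k x"])
        next
          case D: False
          have s: "(v i x)\<^sup>2 \<le> F i x" for i using D by (simp add: F_def)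
          show ?thesis using sq[of "v j x" "- v k x"] s[of j] s[of k] F0[of j x] F0[of k x] by simp
        qed
      next
        case False
        then show ?thesis using F0[of j x] F0[of k x] by (simp add: v_def off)
      qed
      have "(\<integral>\<^sup>+x. ennreal ((v j x - v k x)\<^sup>2) \<partial>lborel) \<le> (\<integral>\<^sup>+x. ennreal 4 * (ennreal (F j x) + ennreal (F k x)) \<partial>lborel)"
        using pt F0 by (intro nn_integral_mono)
          (simp add: ennreal_plus[symmetric] ennreal_mult[symmetric] ennreal_leI del: ennreal_plus ennreal_numeral)
      also have "\<dots> = ennreal 4 * ((\<integral>\<^sup>+x. ennreal (F j x) \<partial>lborel) + (\<integral>\<^sup>+x. ennreal (F k x) \<partial>lborel))"
        by (subst nn_integral_cmult, measurable, subst nn_integral_add) auto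
      also have "\<dots> \<le> ennreal 4 * (ennreal (e' + 2 ^ DIM('a) * e' + e') + ennreal (e' + 2 ^ DIM('a) * e' + e'))"
        using Fint j k by (intro mult_left_mono add_mono) auto
      also have "\<dots> = ennreal (4 * ((e' + 2 ^ DIM('a) * e' + e') + (e' + 2 ^ DIM('a) * e' + e')))"
      proof -
        have "0 \<le> e' + 2 ^ DIM('a) * e' + e'" using e' by simp
        then show ?thesis by (simp only: ennreal_plus ennreal_mult add_nonneg_nonneg zero_le_numeral)
      qed
      also have "4 * ((e' + 2 ^ DIM('a) * e' + e') + (e' + 2 ^ DIM('a) * e' + e')) = e' * (4 * (4 + 2 * 2 ^ DIM('a)))"
        by (simp add: algebra_simps)
      also have "\<dots> = e"
        unfolding e'_def by (smt (verit) nonzero_eq_divide_eq zero_less_power)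
      finally show ?thesis .
    qed
    then show ?thesis by blast
  qed
  obtain w where "w \<in> borel_measurable lborel" "(\<lambda>k. \<integral>\<^sup>+x. ennreal ((v k x - w x)\<^sup>2) \<partial>lborel) \<longlonglongrightarrow> 0"
    by (rule L2_complete[of v lborel]) (use Cauchy in auto)
  then show thesis using r that[of r w] by (simp add: v_def)
qed

section \<open>The weighted Sobolev space\<close>

lemma test_fun_has_derivative:
  assumes "test_fun \<Omega> \<phi>"
  shows "(\<phi> has_derivative (\<lambda>v. cgrad \<phi> x \<bullet> v)) (at x)"
proof -
  have "\<phi> differentiable (at x)"
    using assms by (auto simp: test_fun_def elim: smooth_fun.cases)
  then have D: "(\<phi> has_derivative frechet_derivative \<phi> (at x)) (at x)"
    by (simp add: frechet_derivative_works)
  interpret linear "frechet_derivative \<phi> (at x)"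
    using D by (rule has_derivative_linear)
  have "frechet_derivative \<phi> (at x) v = cgrad \<phi> x \<bullet> v" for v
  proof -
    have "v = (\<Sum>i\<in>UNIV. v $ i *\<^sub>R axis i 1)"
      using basis_expansion[of v] by (simp add: scalar_mult_eq_scaleR)
    then have "frechet_derivative \<phi> (at x) v = frechet_derivative \<phi> (at x) (\<Sum>i\<in>UNIV. v $ i *\<^sub>R axis i 1)"
      by simp
    also have "\<dots> = cgrad \<phi> x \<bullet> v"
      by (simp add: sum scale cgrad_def inner_vec_def mult.commute)
    finally show ?thesis .
  qed
  with D show ?thesis by (metis (no_types, lifting) ext)
qed

text \<open>Unfolding the coinductive \<open>smooth_fun\<close> twice shows that each directional
  derivative is differentiable, hence continuous.\<close>

lemma test_fun_continuous_cgrad: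
  assumes "test_fun \<Omega> \<phi>"
  shows "continuous_on UNIV (cgrad \<phi>)"
proof -
  have "smooth_fun (\<lambda>x. frechet_derivative \<phi> (at x) v)" for v
    using assms by (auto simp: test_fun_def elim: smooth_fun.cases)
  then have "(\<lambda>x. frechet_derivative \<phi> (at x) v) differentiable (at x)" for v x
    by (auto elim: smooth_fun.cases)
  then have "continuous_on UNIV (\<lambda>x. frechet_derivative \<phi> (at x) v)" for v
    by (simp add: continuous_at_imp_continuous_on differentiable_imp_continuous_within)
  then show ?thesis
    unfolding cgrad_def by (intro continuous_on_vec_lambda)
qed

text \<open>The complement of the closed support is open, so \<open>\<phi>\<close> agrees with 0
  near \<open>x\<close> and its derivative vanishes there. This is what makes extension by zero
  compatible with gradients.\<close>

lemma test_fun_zero: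
  assumes "test_fun \<Omega> \<phi>" and "x \<notin> closure {x. \<phi> x \<noteq> 0}"
  shows "\<phi> x = 0" "cgrad \<phi> x = 0"
proof -
  show "\<phi> x = 0"
    using assms(2) closure_subset[of "{x. \<phi> x \<noteq> 0}"] by auto
  have "((\<lambda>_. 0) has_derivative (\<lambda>v. cgrad \<phi> x \<bullet> v)) (at x)"
  proof (rule has_derivative_transform_within_open[OF test_fun_has_derivative[OF assms(1)]])
    show "x \<in> - closure {x. \<phi> x \<noteq> 0}" using assms(2) by simp
    show "\<phi> y = 0" if "y \<in> - closure {x. \<phi> x \<noteq> 0}" for y
      using that closure_subset[of "{x. \<phi> x \<noteq> 0}"] by auto
  qed auto
  then have "(\<lambda>v. cgrad \<phi> x \<bullet> v) = (\<lambda>v. 0)"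
    by (rule has_derivative_unique) (rule has_derivative_const)
  then show "cgrad \<phi> x = 0"
    by (metis inner_eq_zero_iff)
qed

section \<open>Borel representatives on the whole space\<close>

lemma set_integrable_compact_support:
  fixes f :: "'a::euclidean_space \<Rightarrow> 'b::euclidean_space"
  assumes cont: "continuous_on UNIV f" and S: "compact S" and zero: "\<And>x. x \<notin> S \<Longrightarrow> f x = 0"
    and \<Omega>: "\<Omega> \<in> sets lebesgue"
  shows "set_integrable lebesgue \<Omega> f"
proof -
  have "integrable lborel (\<lambda>x. indicator S x *\<^sub>R f x)"
    using S cont by (intro borel_integrable_compact) (auto intro: continuous_on_subset)
  also have "(\<lambda>x. indicator S x *\<^sub>R f x) = f"
    using zero by (auto simp: indicator_def fun_eq_iff)
  finally have "integrable lebesgue f"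
    by (subst integrable_completion) auto
  then show ?thesis
    unfolding set_integrable_def by (intro integrable_mult_indicator \<Omega>)
qed

text \<open>Sobolev functions are given as Lebesgue measurable, whereas the estimates along segments
  use Fubini and affine substitutions for Borel functions on \<open>lborel\<close>.\<close>

lemma borel_representative:
  assumes "set_integrable lebesgue \<Omega> f"
  obtains f' :: "'a::euclidean_space \<Rightarrow> real" where "f' \<in> borel_measurable borel"
    "AE x in lborel. x \<in> \<Omega> \<longrightarrow> f x = f' x"
proof -
  have "(\<lambda>x. indicator \<Omega> x *\<^sub>R f x) \<in> borel_measurable lebesgue"
    using assms by (auto simp: set_integrable_def)
  then obtain f' where "f' \<in> borel_measurable lborel" "AE x in lborel. indicator \<Omega> x *\<^sub>R f x = f' x"
    by (rule completion_ex_borel_measurable_real[THEN bexE]) auto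
  then show thesis
    by (intro that[of f']) (auto elim: eventually_mono)
qed

text \<open>Translates the Bochner integrals over \<Omega> in the definitions into nonnegative
  integrals over the whole space. Integrability is assumed because a Bochner integral defaults to 0
  without it.\<close>

lemma nn_integral_lborel_eq_set_integral:
  assumes int: "set_integrable lebesgue \<Omega> f" and nonneg: "\<And>x. x \<in> \<Omega> \<Longrightarrow> 0 \<le> f x"
    and eq: "AE x in lborel. F x = ennreal (indicator \<Omega> x * f x)"
  shows "(\<integral>\<^sup>+x. F x \<partial>lborel) = ennreal (LINT x:\<Omega>|lebesgue. f x)"
proof -
  have "(\<integral>\<^sup>+x. F x \<partial>lborel) = (\<integral>\<^sup>+x. ennreal (indicator \<Omega> x * f x) \<partial>lborel)"
    using eq by (rule nn_integral_cong_AE)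
  also have "\<dots> = (\<integral>\<^sup>+x. ennreal (indicator \<Omega> x *\<^sub>R f x) \<partial>lebesgue)"
    by (simp add: nn_integral_completion)
  also have "\<dots> = ennreal (LINT x:\<Omega>|lebesgue. f x)"
    unfolding set_lebesgue_integral_def
    using int nonneg by (intro nn_integral_eq_integral) (auto simp: set_integrable_def indicator_def)
  finally show ?thesis .
qed

text \<open>Extends an element and its weak gradient by zero. The chord estimate passes from the
  approximating test functions to the extension, and ellipticity bounds the weighted integral of
  |G|^2 by the energy at the price 1/\<beta>.\<close>

lemma H01_representative:
  fixes \<Omega> :: "(real^'n) set" and A :: "real^'n \<Rightarrow> real^'n^'n"
  assumes op: "open \<Omega>" and b: "\<beta> > 0"
    and ell: "\<And>x \<zeta>. x \<in> \<Omega> \<Longrightarrow> \<beta> * (norm \<zeta>)\<^sup>2 \<le> \<zeta> \<bullet> (A x *v \<zeta>)"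
    and z: "z \<in> H01 \<Omega> A \<alpha>"
  obtains u G where "u \<in> borel_measurable borel" "G \<in> borel_measurable borel"
    "\<And>x. x \<notin> \<Omega> \<Longrightarrow> u x = 0" "AE x in lborel. x \<in> \<Omega> \<longrightarrow> z x = u x"
    "chord_bounded u G"
    "(\<integral>\<^sup>+x. ennreal (norm x powr \<alpha> * (norm (G x))\<^sup>2) \<partial>lborel) \<le> ennreal (Hnorm2 \<Omega> A \<alpha> z / \<beta>)"
proof -
  have [measurable]: "\<Omega> \<in> sets borel" using op by simp
  \<comment> \<open>\<open>wgrad\<close> is a choice, shown by \<open>someI_ex\<close> to be a weak
    gradient; \<open>W011\<close>, \<open>H01\<close> and \<open>Hnorm2\<close> all refer to this
    same function.\<close>
  define g where "g = wgrad \<Omega> z"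
  from z have "\<exists>g. weak_grad \<Omega> z g" by (simp add: H01_def W011_def)
  then have "weak_grad \<Omega> z g" unfolding g_def wgrad_def by (rule someI_ex)
  then have zint: "set_integrable lebesgue \<Omega> z" and gint: "\<And>i. set_integrable lebesgue \<Omega> (\<lambda>x. g x $ i)"
    by (auto simp: weak_grad_def)
  from z obtain \<phi> where \<phi>: "\<And>k. test_fun \<Omega> (\<phi> k)"
    and l0: "(\<lambda>k. LINT x:\<Omega>|lebesgue. \<bar>\<phi> k x - z x\<bar>) \<longlonglongrightarrow> 0"
    and l1: "(\<lambda>k. LINT x:\<Omega>|lebesgue. norm (cgrad (\<phi> k) x - g x)) \<longlonglongrightarrow> 0"
    unfolding H01_def W011_def g_def by blast
  have eint: "set_integrable lebesgue \<Omega> (\<lambda>x. norm x powr \<alpha> * ((A x *v g x) \<bullet> g x))"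
    using z by (simp add: H01_def g_def)

  obtain z' where z' [measurable]: "z' \<in> borel_measurable borel" and z'eq: "AE x in lborel. x \<in> \<Omega> \<longrightarrow> z x = z' x"
    using borel_representative[OF zint] .
  have "\<exists>g'. \<forall>i. g' i \<in> borel_measurable borel \<and> (AE x in lborel. x \<in> \<Omega> \<longrightarrow> g x $ i = g' i x)"
    by (intro choice allI) (metis borel_representative[OF gint])
  then obtain g' where g' [measurable]: "\<And>i. g' i \<in> borel_measurable borel"
    and g'eq: "\<And>i. AE x in lborel. x \<in> \<Omega> \<longrightarrow> g x $ i = g' i x" by blast
  \<comment> \<open>Extension by zero outside \<Omega>. The test functions and their gradients
    vanish there too, so the two L^1 limits over \<Omega> become limits over the whole
    space.\<close>
  define u where "u x = indicator \<Omega> x * z' x" for x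
  define G where "G x = indicator \<Omega> x *\<^sub>R (\<chi> i. g' i x)" for x
  have um [measurable]: "u \<in> borel_measurable borel" unfolding u_def by measurable
  have Gm [measurable]: "G \<in> borel_measurable borel"
  proof -
    have "(\<lambda>x. \<chi> i. g' i x) \<in> borel_measurable borel"
      by (subst borel_measurable_euclidean_space) (auto simp: Basis_vec_def inner_axis)
    then show ?thesis unfolding G_def by (intro borel_measurable_scaleR) auto
  qed
  have ueq: "AE x in lborel. x \<in> \<Omega> \<longrightarrow> z x = u x"
    using z'eq by eventually_elim (simp add: u_def)
  have "AE x in lborel. \<forall>i\<in>UNIV. x \<in> \<Omega> \<longrightarrow> g x $ i = g' i x"
    by (intro AE_finite_allI g'eq) auto
  then have Geq: "AE x in lborel. x \<in> \<Omega> \<longrightarrow> g x = G x"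
    by eventually_elim (simp add: G_def vec_eq_iff)

  have off: "\<phi> k x = 0" "cgrad (\<phi> k) x = 0" if "x \<notin> \<Omega>" for k x
  proof -
    have "x \<notin> closure {x. \<phi> k x \<noteq> 0}"
      using \<phi>[of k] that unfolding test_fun_def by blast
    then show "\<phi> k x = 0" "cgrad (\<phi> k) x = 0"
      using test_fun_zero[OF \<phi>[of k]] by blast+
  qed
  have cont\<phi>: "continuous_on UNIV (\<phi> k)" for k
    using test_fun_has_derivative[OF \<phi>[of k]]
    by (intro continuous_at_imp_continuous_on ballI has_derivative_continuous) blast
  have [measurable]: "\<phi> k \<in> borel_measurable borel" "cgrad (\<phi> k) \<in> borel_measurable borel" for k
    using cont\<phi> test_fun_continuous_cgrad[OF \<phi>[of k]] by (auto intro: borel_measurable_continuous_onI)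
  have \<phi>int: "set_integrable lebesgue \<Omega> (\<phi> k)" "set_integrable lebesgue \<Omega> (cgrad (\<phi> k))" for k
  proof -
    have S: "compact (closure {x. \<phi> k x \<noteq> 0})" using \<phi>[of k] by (simp add: test_fun_def)
    show "set_integrable lebesgue \<Omega> (\<phi> k)"
      by (rule set_integrable_compact_support[OF cont\<phi> S test_fun_zero(1)[OF \<phi>]]) auto
    show "set_integrable lebesgue \<Omega> (cgrad (\<phi> k))"
      by (rule set_integrable_compact_support[OF test_fun_continuous_cgrad[OF \<phi>] S test_fun_zero(2)[OF \<phi>]]) auto
  qed

  have "(\<integral>\<^sup>+x. ennreal \<bar>\<phi> k x - u x\<bar> \<partial>lborel) = ennreal (LINT x:\<Omega>|lebesgue. \<bar>\<phi> k x - z x\<bar>)" for k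
  proof (rule nn_integral_lborel_eq_set_integral)
    show "set_integrable lebesgue \<Omega> (\<lambda>x. \<bar>\<phi> k x - z x\<bar>)"
      by (intro set_integrable_abs set_integral_diff \<phi>int zint)
    show "AE x in lborel. ennreal \<bar>\<phi> k x - u x\<bar> = ennreal (indicator \<Omega> x * \<bar>\<phi> k x - z x\<bar>)"
      using ueq by eventually_elim (auto simp: indicator_def off u_def)
  qed simp
  then have lim0: "(\<lambda>k. \<integral>\<^sup>+x. ennreal \<bar>\<phi> k x - u x\<bar> \<partial>lborel) \<longlonglongrightarrow> 0"
    using tendsto_ennrealI[OF l0] by simp

  have "(\<integral>\<^sup>+x. ennreal (norm (cgrad (\<phi> k) x - G x)) \<partial>lborel) =
     ennreal (LINT x:\<Omega>|lebesgue. norm (cgrad (\<phi> k) x - g x))" for k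
  proof (rule nn_integral_lborel_eq_set_integral)
    have comp: "set_integrable lebesgue \<Omega> (\<lambda>x. (cgrad (\<phi> k) x - g x) $ i)" for i
    proof -
      have "set_integrable lebesgue \<Omega> (\<lambda>x. cgrad (\<phi> k) x \<bullet> axis i 1)"
        using integrable_inner_left[of "axis i 1", OF \<phi>int(2)[of k, unfolded set_integrable_def]]
        by (simp add: set_integrable_def)
      then have "set_integrable lebesgue \<Omega> (\<lambda>x. cgrad (\<phi> k) x $ i)"
        by (simp add: inner_axis)
      from set_integral_diff(1)[OF this gint[of i]] show ?thesis by simp
    qed
    then have meas: "(\<lambda>x. indicator \<Omega> x *\<^sub>R (cgrad (\<phi> k) x - g x) $ i) \<in> borel_measurable lebesgue" for i
      unfolding set_integrable_def by (rule borel_measurable_integrable)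
    \<comment> \<open>Integrability of \<open>g\<close> is known by components, so the norm is
      measured as a root of a sum of squares and dominated by the sum of the moduli of the
      components.\<close>
    show "set_integrable lebesgue \<Omega> (\<lambda>x. norm (cgrad (\<phi> k) x - g x))"
      unfolding set_integrable_def
    proof (rule Bochner_Integration.integrable_bound)
      show "integrable lebesgue (\<lambda>x. \<Sum>i\<in>UNIV. \<bar>indicator \<Omega> x *\<^sub>R (cgrad (\<phi> k) x - g x) $ i\<bar>)"
        using comp unfolding set_integrable_def by (intro Bochner_Integration.integrable_sum integrable_abs)
      have "(\<lambda>x. indicator \<Omega> x *\<^sub>R norm (cgrad (\<phi> k) x - g x)) =
          (\<lambda>x. sqrt (\<Sum>i\<in>UNIV. (indicator \<Omega> x *\<^sub>R (cgrad (\<phi> k) x - g x) $ i)\<^sup>2))"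
        by (auto simp: fun_eq_iff norm_vec_def L2_set_def indicator_def)
      also have "\<dots> \<in> borel_measurable lebesgue"
        by (intro measurable_compose[OF _ borel_measurable_sqrt] borel_measurable_sum borel_measurable_power meas)
      finally show "(\<lambda>x. indicator \<Omega> x *\<^sub>R norm (cgrad (\<phi> k) x - g x)) \<in> borel_measurable lebesgue" .
      show "AE x in lebesgue. norm (indicator \<Omega> x *\<^sub>R norm (cgrad (\<phi> k) x - g x)) \<le>
          norm (\<Sum>i\<in>UNIV. \<bar>indicator \<Omega> x *\<^sub>R (cgrad (\<phi> k) x - g x) $ i\<bar>)"
      proof (rule AE_I2)
        fix x
        have "norm (cgrad (\<phi> k) x - g x) \<le> (\<Sum>i\<in>UNIV. \<bar>(cgrad (\<phi> k) x - g x) $ i\<bar>)"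
          by (rule norm_le_l1_cart)
        then show "norm (indicator \<Omega> x *\<^sub>R norm (cgrad (\<phi> k) x - g x)) \<le>
            norm (\<Sum>i\<in>UNIV. \<bar>indicator \<Omega> x *\<^sub>R (cgrad (\<phi> k) x - g x) $ i\<bar>)"
          by (cases "x \<in> \<Omega>") (auto simp: abs_of_nonneg sum_nonneg)
      qed
    qed
    show "AE x in lborel. ennreal (norm (cgrad (\<phi> k) x - G x)) =
        ennreal (indicator \<Omega> x * norm (cgrad (\<phi> k) x - g x))"
      using Geq by eventually_elim (auto simp: indicator_def off G_def)
  qed simp
  then have lim1: "(\<lambda>k. \<integral>\<^sup>+x. ennreal (norm (cgrad (\<phi> k) x - G x)) \<partial>lborel) \<longlonglongrightarrow> 0"
    using tendsto_ennrealI[OF l1] by simp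

  have chord: "chord_bounded u G"
    unfolding chord_bounded_def
    by (intro allI impI chord_estimate_limit[OF um Gm _ _ lim0 lim1]
        chord_estimate_C1 test_fun_has_derivative[OF \<phi>] test_fun_continuous_cgrad[OF \<phi>]) auto

  have nonneg: "0 \<le> (A x *v \<zeta>) \<bullet> \<zeta>" if "x \<in> \<Omega>" for x \<zeta>
  proof -
    have "0 \<le> \<beta> * (norm \<zeta>)\<^sup>2" using b by simp
    then show ?thesis using ell[OF that, of \<zeta>] by (simp add: inner_commute)
  qed
  \<comment> \<open>Ellipticity inside \<Omega>, and \<open>G\<close> = 0 outside.\<close>
  have "(\<integral>\<^sup>+x. ennreal (norm x powr \<alpha> * (norm (G x))\<^sup>2) \<partial>lborel) \<le>
     (\<integral>\<^sup>+x. ennreal (indicator \<Omega> x * (1 / \<beta> * (norm x powr \<alpha> * ((A x *v g x) \<bullet> g x)))) \<partial>lborel)"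
    using Geq
  proof (intro nn_integral_mono_AE, eventually_elim)
    case (elim x)
    show ?case
    proof (cases "x \<in> \<Omega>")
      case True
      have "(norm (g x))\<^sup>2 \<le> 1 / \<beta> * ((A x *v g x) \<bullet> g x)"
        using ell[OF True, of "g x"] b by (simp add: field_simps inner_commute)
      then have "norm x powr \<alpha> * (norm (g x))\<^sup>2 \<le> norm x powr \<alpha> * (1 / \<beta> * ((A x *v g x) \<bullet> g x))"
        by (rule mult_left_mono) simp
      then show ?thesis using True elim by (auto intro!: ennreal_leI simp: mult_ac)
    qed (simp add: G_def)
  qed
  also have "\<dots> = ennreal (LINT x:\<Omega>|lebesgue. 1 / \<beta> * (norm x powr \<alpha> * ((A x *v g x) \<bullet> g x)))"
    using b nonneg by (intro nn_integral_lborel_eq_set_integral set_integrable_mult_right eint) auto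
  also have "\<dots> = ennreal (Hnorm2 \<Omega> A \<alpha> z / \<beta>)"
    by (simp add: Hnorm2_def g_def)
  finally show thesis
    using that[OF um Gm _ ueq chord] by (simp add: u_def)
qed

lemma L2_if_AE_eq:
  fixes z :: "real^'n \<Rightarrow> real"
  assumes [measurable]: "\<Omega> \<in> sets borel"
    and meas: "(\<lambda>x. indicator \<Omega> x *\<^sub>R z x) \<in> borel_measurable lebesgue"
    and eq: "AE x in lborel. x \<in> \<Omega> \<longrightarrow> z x = u x"
    and fin: "(\<integral>\<^sup>+x. ennreal ((u x)\<^sup>2) \<partial>lborel) < \<infinity>"
  shows "L2 \<Omega> z"
proof -
  have "z \<in> borel_measurable (lebesgue_on \<Omega>)"
    using meas by (subst borel_measurable_restrict_space_iff) auto
  moreover have "integrable lebesgue (\<lambda>x. indicator \<Omega> x *\<^sub>R (z x)\<^sup>2)"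
  proof (rule integrableI_bounded)
    have "(\<lambda>x. indicator \<Omega> x *\<^sub>R (z x)\<^sup>2) = (\<lambda>x. (indicator \<Omega> x *\<^sub>R z x)\<^sup>2)"
      by (auto simp: indicator_def fun_eq_iff)
    also have "\<dots> \<in> borel_measurable lebesgue"
      by (intro borel_measurable_power meas)
    finally show "(\<lambda>x. indicator \<Omega> x *\<^sub>R (z x)\<^sup>2) \<in> borel_measurable lebesgue" .
    have "(\<integral>\<^sup>+x. ennreal (norm (indicator \<Omega> x *\<^sub>R (z x)\<^sup>2)) \<partial>lborel) \<le> (\<integral>\<^sup>+x. ennreal ((u x)\<^sup>2) \<partial>lborel)"
      using eq by (intro nn_integral_mono_AE, eventually_elim) (auto simp: indicator_def)
    then show "(\<integral>\<^sup>+x. ennreal (norm (indicator \<Omega> x *\<^sub>R (z x)\<^sup>2)) \<partial>lebesgue) < \<infinity>"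
      using fin by (simp add: nn_integral_completion)
  qed
  ultimately show ?thesis by (simp add: L2_def set_integrable_def)
qed

lemma H01_measurable:
  assumes "z \<in> H01 \<Omega> A \<alpha>"
  shows "(\<lambda>x. indicator \<Omega> x *\<^sub>R z x) \<in> borel_measurable lebesgue"
proof -
  have "set_integrable lebesgue \<Omega> z"
    using assms by (auto simp: H01_def W011_def weak_grad_def)
  then show ?thesis unfolding set_integrable_def by (rule borel_measurable_integrable)
qed

section \<open>Compactness of the embedding into L^2\<close>

theorem theorem3p4:
  fixes \<Omega> :: "(real^'n) set" and A :: "real^'n \<Rightarrow> real^'n^'n" and \<alpha> \<beta> :: real
  assumes "CARD('n) \<ge> 2"
    and "0 < \<alpha>" and "\<alpha> < 2"
    and "open \<Omega>" and "bounded \<Omega>" and "0 \<in> \<Omega>" and "C2_boundary \<Omega>"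
    and "\<forall>x\<in>closure \<Omega>. transpose (A x) = A x"
    and "\<forall>i j. C1_closure \<Omega> (\<lambda>x. A x $ i $ j)"
    and "\<beta> > 0"
    and "\<forall>x\<in>closure \<Omega>. \<forall>\<zeta>. \<zeta> \<bullet> (A x *v \<zeta>) \<ge> \<beta> * (norm \<zeta>)\<^sup>2"
  shows "(\<forall>z\<in>H01 \<Omega> A \<alpha>. L2 \<Omega> z) \<and>
    (\<forall>z::nat \<Rightarrow> real^'n \<Rightarrow> real. (\<forall>k. z k \<in> H01 \<Omega> A \<alpha>) \<and> bounded (range (\<lambda>k. Hnorm2 \<Omega> A \<alpha> (z k)))
      \<longrightarrow> (\<exists>r w. strict_mono r \<and> L2 \<Omega> w \<and>
             (\<lambda>k. LINT x:\<Omega>|lebesgue. (z (r k) x - w x)\<^sup>2) \<longlonglongrightarrow> 0))"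
proof -
  have [measurable]: "\<Omega> \<in> sets borel" using \<open>open \<Omega>\<close> by simp
  have dim: "DIM(real^'n) \<ge> 2" using assms(1) by simp
  have ell: "\<beta> * (norm \<zeta>)\<^sup>2 \<le> \<zeta> \<bullet> (A x *v \<zeta>)" if "x \<in> \<Omega>" for x \<zeta>
    using assms(11) that closure_subset by blast
  obtain R0 where R0: "\<And>x. x \<in> \<Omega> \<Longrightarrow> norm x \<le> R0"
    using \<open>bounded \<Omega>\<close> by (auto simp: bounded_iff)
  define R where "R = \<bar>R0\<bar> + 1"
  have R: "R > 0" by (simp add: R_def)
  have out: "x \<notin> \<Omega>" if "R \<le> norm x" for x using R0[of x] that by (auto simp: R_def)
  define c where "c = (2 / \<alpha>)\<^sup>2"
  have c: "c \<ge> 0" by (simp add: c_def)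

  \<comment> \<open>Applied at two scales: radius \<open>R\<close> covers \<Omega> and bounds the
    full L^2 norm, a small radius rules out concentration at the origin.\<close>
  have hardy: "(\<integral>\<^sup>+x. ennreal ((u x)\<^sup>2) * indicator (ball 0 \<epsilon>) x \<partial>lborel) \<le> ennreal (c * \<epsilon> powr (2 - \<alpha>) * H)"
    if "u \<in> borel_measurable borel" "G \<in> borel_measurable borel" "\<And>x. x \<notin> \<Omega> \<Longrightarrow> u x = 0"
      "chord_bounded u G" "(\<integral>\<^sup>+x. ennreal (norm x powr \<alpha> * (norm (G x))\<^sup>2) \<partial>lborel) \<le> ennreal H"
      "\<epsilon> > 0" "H \<ge> 0" for u :: "real^'n \<Rightarrow> real" and G H \<epsilon>
  proof -
    have "(\<integral>\<^sup>+x. ennreal ((u x)\<^sup>2) * indicator (ball 0 \<epsilon>) x \<partial>lborel) \<le>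
        ennreal (c * \<epsilon> powr (2 - \<alpha>)) * (\<integral>\<^sup>+x. ennreal (norm x powr \<alpha> * (norm (G x))\<^sup>2) \<partial>lborel)"
      unfolding c_def using that(3)[OF out] that assms(2,3) dim R
      by (intro weighted_Hardy_estimate[where R=R]) blast+
    also have "\<dots> \<le> ennreal (c * \<epsilon> powr (2 - \<alpha>)) * ennreal H"
      by (intro mult_left_mono that) auto
    finally show ?thesis using c that by (simp add: ennreal_mult)
  qed
  have total: "(\<integral>\<^sup>+x. ennreal ((u x)\<^sup>2) \<partial>lborel) \<le> ennreal (c * R powr (2 - \<alpha>) * H)"
    if "u \<in> borel_measurable borel" "G \<in> borel_measurable borel" "\<And>x. x \<notin> \<Omega> \<Longrightarrow> u x = 0"
      "chord_bounded u G" "(\<integral>\<^sup>+x. ennreal (norm x powr \<alpha> * (norm (G x))\<^sup>2) \<partial>lborel) \<le> ennreal H"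
      "H \<ge> 0" for u :: "real^'n \<Rightarrow> real" and G H
  proof -
    have "(\<integral>\<^sup>+x. ennreal ((u x)\<^sup>2) \<partial>lborel) = (\<integral>\<^sup>+x. ennreal ((u x)\<^sup>2) * indicator (ball 0 R) x \<partial>lborel)"
      using that(3)[OF out] by (intro nn_integral_cong) (auto simp: indicator_def)
    then show ?thesis using hardy[OF that(1-5) R that(6)] by simp
  qed

  have "L2 \<Omega> z" if z: "z \<in> H01 \<Omega> A \<alpha>" for z
  proof -
    obtain u G where rep: "u \<in> borel_measurable borel" "G \<in> borel_measurable borel"
      "\<And>x. x \<notin> \<Omega> \<Longrightarrow> u x = 0" "AE x in lborel. x \<in> \<Omega> \<longrightarrow> z x = u x" "chord_bounded u G"
      "(\<integral>\<^sup>+x. ennreal (norm x powr \<alpha> * (norm (G x))\<^sup>2) \<partial>lborel) \<le> ennreal (Hnorm2 \<Omega> A \<alpha> z / \<beta>)"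
      using H01_representative[OF \<open>open \<Omega>\<close> \<open>\<beta> > 0\<close> ell z] by blast
    have "(\<integral>\<^sup>+x. ennreal (norm x powr \<alpha> * (norm (G x))\<^sup>2) \<partial>lborel) \<le> ennreal \<bar>Hnorm2 \<Omega> A \<alpha> z / \<beta>\<bar>"
      using rep(6) by (rule order_trans) (intro ennreal_leI abs_ge_self)
    from total[OF rep(1-3,5) this] have "(\<integral>\<^sup>+x. ennreal ((u x)\<^sup>2) \<partial>lborel) < \<infinity>"
      by (auto intro: le_less_trans)
    then show ?thesis by (intro L2_if_AE_eq[OF _ H01_measurable[OF z] rep(4)]) auto
  qed
  moreover
  have "\<exists>r w. strict_mono r \<and> L2 \<Omega> w \<and> (\<lambda>k. LINT x:\<Omega>|lebesgue. (z (r k) x - w x)\<^sup>2) \<longlonglongrightarrow> 0"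
    if z: "\<And>k. z k \<in> H01 \<Omega> A \<alpha>" and bdd: "bounded (range (\<lambda>k. Hnorm2 \<Omega> A \<alpha> (z k)))"
    for z :: "nat \<Rightarrow> real^'n \<Rightarrow> real"
  proof -
    obtain H0 where H0: "\<And>k. \<bar>Hnorm2 \<Omega> A \<alpha> (z k)\<bar> \<le> H0"
      using bdd by (auto simp: bounded_iff)
    define H where "H = H0 / \<beta>"
    have H: "H \<ge> 0" using H0[of 0] \<open>\<beta> > 0\<close> by (simp add: H_def)
    \<comment> \<open>Bundling the conditions lets \<open>u\<close> and \<open>G\<close> be chosen
      for all \<open>k\<close> at once, with an energy bound \<open>H\<close> independent of
      \<open>k\<close>.\<close>
    define rep_of where "rep_of k u G \<longleftrightarrow> u \<in> borel_measurable borel \<and> G \<in> borel_measurable borel \<and>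
      (\<forall>x. x \<notin> \<Omega> \<longrightarrow> u x = 0) \<and> (AE x in lborel. x \<in> \<Omega> \<longrightarrow> z k x = u x) \<and> chord_bounded u G \<and>
      (\<integral>\<^sup>+x. ennreal (norm x powr \<alpha> * (norm (G x))\<^sup>2) \<partial>lborel) \<le> ennreal H" for k u G
    have "\<exists>u G. rep_of k u G" for k
    proof -
      obtain u G where rep: "u \<in> borel_measurable borel" "G \<in> borel_measurable borel"
        "\<And>x. x \<notin> \<Omega> \<Longrightarrow> u x = 0" "AE x in lborel. x \<in> \<Omega> \<longrightarrow> z k x = u x" "chord_bounded u G"
        "(\<integral>\<^sup>+x. ennreal (norm x powr \<alpha> * (norm (G x))\<^sup>2) \<partial>lborel) \<le> ennreal (Hnorm2 \<Omega> A \<alpha> (z k) / \<beta>)"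
        using H01_representative[OF \<open>open \<Omega>\<close> \<open>\<beta> > 0\<close> ell z] by blast
      have "Hnorm2 \<Omega> A \<alpha> (z k) / \<beta> \<le> H"
        using H0[of k] \<open>\<beta> > 0\<close> by (simp add: H_def divide_right_mono)
      then have "(\<integral>\<^sup>+x. ennreal (norm x powr \<alpha> * (norm (G x))\<^sup>2) \<partial>lborel) \<le> ennreal H"
        using rep(6) ennreal_leI order_trans by blast
      with rep show ?thesis unfolding rep_of_def by blast
    qed
    then obtain u G where "\<And>k. rep_of k (u k) (G k)" by metis
    then have um [measurable]: "\<And>k. u k \<in> borel_measurable borel"
      and Gm [measurable]: "\<And>k. G k \<in> borel_measurable borel"
      and off: "\<And>k x. x \<notin> \<Omega> \<Longrightarrow> u k x = 0"
      and zu: "\<And>k. AE x in lborel. x \<in> \<Omega> \<longrightarrow> z k x = u k x"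
      and chord: "\<And>k. chord_bounded (u k) (G k)"
      and energy: "\<And>k. (\<integral>\<^sup>+x. ennreal (norm x powr \<alpha> * (norm (G k x))\<^sup>2) \<partial>lborel) \<le> ennreal H"
      unfolding rep_of_def by blast+
    note ub = total[OF um Gm off chord energy H]
    have equi: "\<exists>D\<in>sets borel. \<exists>\<delta>>0. \<forall>k.
      (\<integral>\<^sup>+x. ennreal ((u k x)\<^sup>2) * indicator (- D) x \<partial>lborel) \<le> ennreal e \<and>
      (\<forall>h. norm h \<le> \<delta> \<longrightarrow>
        (\<integral>\<^sup>+x. ennreal ((u k (h + x) - u k x)\<^sup>2) * indicator D x \<partial>lborel) \<le> ennreal e)" if e: "e > 0" for e
    proof -
      \<comment> \<open>Solves (2 \<epsilon>)^(2-\<alpha>) = e / (c H + 1), so Hardy on the ball of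
        radius 2 \<epsilon> gives at most e c H / (c H + 1). The added 1 avoids division by
        zero.\<close>
      define \<epsilon> where "\<epsilon> = (e / (c * H + 1)) powr (1 / (2 - \<alpha>)) / 2"
      \<comment> \<open>The first bound is the condition |h| \<le> \<epsilon> of the translation
        estimate; the second makes |h|^2 \<epsilon>^(-\<alpha>) H at most e H / (H + 1).\<close>
      define \<delta> where "\<delta> = min \<epsilon> (sqrt (e * \<epsilon> powr \<alpha> / (H + 1)))"
      have cH: "c * H + 1 > 0" using c H by (simp add: add_nonneg_pos)
      have \<epsilon>: "\<epsilon> > 0" unfolding \<epsilon>_def using e cH by simp
      have pw: "(2 * \<epsilon>) powr (2 - \<alpha>) = e / (c * H + 1)"
        unfolding \<epsilon>_def using e cH assms(3) by (simp add: powr_powr)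
      have \<delta>: "\<delta> > 0" unfolding \<delta>_def using \<epsilon> e H by simp
      define D where "D = {x::real^'n. 2 * \<epsilon> \<le> norm x}"
      have D: "D \<in> sets borel" unfolding D_def by measurable
      have mD: "- D = ball 0 (2 * \<epsilon>)" by (auto simp: D_def)
      have near: "(\<integral>\<^sup>+x. ennreal ((u k x)\<^sup>2) * indicator (- D) x \<partial>lborel) \<le> ennreal e" for k
      proof -
        have "(\<integral>\<^sup>+x. ennreal ((u k x)\<^sup>2) * indicator (- D) x \<partial>lborel) \<le> ennreal (c * (2 * \<epsilon>) powr (2 - \<alpha>) * H)"
          unfolding mD using \<epsilon> by (intro hardy[OF um Gm off chord energy _ H]) auto
        also have "c * (2 * \<epsilon>) powr (2 - \<alpha>) * H = e * ((c * H) / (c * H + 1))"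
          unfolding pw by simp
        also have "ennreal \<dots> \<le> ennreal e"
          using e cH c H by (intro ennreal_leI mult_left_le) (auto simp: divide_le_eq)
        finally show ?thesis .
      qed
      have far: "(\<integral>\<^sup>+x. ennreal ((u k (h + x) - u k x)\<^sup>2) * indicator D x \<partial>lborel) \<le> ennreal e"
        if h: "norm h \<le> \<delta>" for k h
      proof -
        have "(norm h)\<^sup>2 \<le> (sqrt (e * \<epsilon> powr \<alpha> / (H + 1)))\<^sup>2"
          using h by (intro power_mono) (auto simp: \<delta>_def)
        also have "\<dots> = e * \<epsilon> powr \<alpha> / (H + 1)"
          using e H by simp
        finally have h2: "(norm h)\<^sup>2 \<le> e * \<epsilon> powr \<alpha> / (H + 1)" .
        have "(\<integral>\<^sup>+x. ennreal ((u k (h + x) - u k x)\<^sup>2) * indicator D x \<partial>lborel) \<le>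
          ennreal ((norm h)\<^sup>2 * \<epsilon> powr - \<alpha>) * (\<integral>\<^sup>+x. ennreal (norm x powr \<alpha> * (norm (G k x))\<^sup>2) \<partial>lborel)"
          unfolding D_def using h assms(2) by (intro translation_estimate[OF um Gm chord \<epsilon>]) (auto simp: \<delta>_def)
        also have "\<dots> \<le> ennreal ((norm h)\<^sup>2 * \<epsilon> powr - \<alpha>) * ennreal H"
          by (intro mult_left_mono energy) auto
        also have "\<dots> = ennreal ((norm h)\<^sup>2 * \<epsilon> powr - \<alpha> * H)"
          using H by (simp add: ennreal_mult)
        also have "\<dots> \<le> ennreal (e * \<epsilon> powr \<alpha> / (H + 1) * \<epsilon> powr - \<alpha> * H)"
          using h2 H by (intro ennreal_leI mult_right_mono) auto
        also have "e * \<epsilon> powr \<alpha> / (H + 1) * \<epsilon> powr - \<alpha> * H = e * (H / (H + 1))"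
          using \<epsilon> by (simp add: powr_minus field_simps)
        also have "ennreal \<dots> \<le> ennreal e"
          using e H by (intro ennreal_leI mult_left_le) (auto simp: divide_le_eq)
        finally show ?thesis .
      qed
      show ?thesis using D \<delta> near far by blast
    qed
    obtain r w where r: "strict_mono (r::nat \<Rightarrow> nat)" and wm [measurable]: "w \<in> borel_measurable borel"
      and lim: "(\<lambda>k. \<integral>\<^sup>+x. ennreal ((u (r k) x - w x)\<^sup>2) \<partial>lborel) \<longlonglongrightarrow> 0"
      by (rule Kolmogorov_Riesz_L2[of u R, OF um off[OF out] ub equi])
    \<comment> \<open>One member of the sequence at L^2 distance less than 1 suffices, since that
      member is square integrable.\<close>
    have w2: "(\<integral>\<^sup>+x. ennreal ((w x)\<^sup>2) \<partial>lborel) < \<infinity>"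
    proof -
      have "\<forall>\<^sub>F k in sequentially. (\<integral>\<^sup>+x. ennreal ((u (r k) x - w x)\<^sup>2) \<partial>lborel) < 1"
        using lim by (rule order_tendstoD) simp
      then obtain k where k: "(\<integral>\<^sup>+x. ennreal ((u (r k) x - w x)\<^sup>2) \<partial>lborel) < 1"
        by (auto simp: eventually_sequentially)
      have "(\<integral>\<^sup>+x. ennreal ((w x)\<^sup>2) \<partial>lborel) \<le>
          (\<integral>\<^sup>+x. ennreal 2 * (ennreal ((u (r k) x - w x)\<^sup>2) + ennreal ((u (r k) x)\<^sup>2)) \<partial>lborel)"
      proof (rule nn_integral_mono)
        fix x
        have "(w x)\<^sup>2 \<le> 2 * ((u (r k) x - w x)\<^sup>2 + (u (r k) x)\<^sup>2)"
          \<comment> \<open>The difference of the two sides is the square of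
            \<open>2 * u (r k) x - w x\<close>.\<close>
          using zero_le_power2[of "2 * u (r k) x - w x"] by (simp add: power2_eq_square algebra_simps)
        then show "ennreal ((w x)\<^sup>2) \<le> ennreal 2 * (ennreal ((u (r k) x - w x)\<^sup>2) + ennreal ((u (r k) x)\<^sup>2))"
          by (simp add: ennreal_plus[symmetric] ennreal_mult[symmetric] ennreal_leI
              del: ennreal_plus ennreal_numeral)
      qed
      also have "\<dots> = ennreal 2 * ((\<integral>\<^sup>+x. ennreal ((u (r k) x - w x)\<^sup>2) \<partial>lborel) +
          (\<integral>\<^sup>+x. ennreal ((u (r k) x)\<^sup>2) \<partial>lborel))"
        by (simp add: nn_integral_cmult nn_integral_add del: ennreal_numeral)
      also have "\<dots> < \<infinity>"
      proof -
        have "(\<integral>\<^sup>+x. ennreal ((u (r k) x - w x)\<^sup>2) \<partial>lborel) < \<infinity>"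
          using k by (rule order.strict_trans) simp
        moreover have "(\<integral>\<^sup>+x. ennreal ((u (r k) x)\<^sup>2) \<partial>lborel) < \<infinity>"
          using le_less_trans[OF ub ennreal_less_top] by simp
        ultimately show ?thesis by (simp add: ennreal_mult_less_top)
      qed
      finally show ?thesis .
    qed
    have "L2 \<Omega> w"
      by (rule L2_if_AE_eq[where u=w, OF _ _ _ w2]) (auto intro!: measurable_completion)
    moreover have "(\<lambda>k. LINT x:\<Omega>|lebesgue. (z (r k) x - w x)\<^sup>2) \<longlonglongrightarrow> 0"
    proof -
      \<comment> \<open>For a nonnegative measurable integrand the Bochner integral is
        \<open>enn2real\<close> of this quantity; if it is infinite, both are 0 by convention.
        Convergence can thus be proved for \<open>I\<close> and carried over at the end.\<close>
      define I where "I k = (\<integral>\<^sup>+x. ennreal (indicator \<Omega> x * (z (r k) x - w x)\<^sup>2) \<partial>lborel)" for k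
      have eqI: "(LINT x:\<Omega>|lebesgue. (z (r k) x - w x)\<^sup>2) = enn2real (I k)" for k
      proof -
        have "(\<lambda>x. indicator \<Omega> x *\<^sub>R (z (r k) x - w x)\<^sup>2) =
            (\<lambda>x. (indicator \<Omega> x *\<^sub>R z (r k) x - indicator \<Omega> x *\<^sub>R w x)\<^sup>2)"
          by (auto simp: indicator_def fun_eq_iff)
        also have "\<dots> \<in> borel_measurable lebesgue"
          by (intro borel_measurable_power borel_measurable_diff H01_measurable[OF z])
            (auto intro!: measurable_completion)
        finally show ?thesis
          unfolding set_lebesgue_integral_def
          by (subst integral_eq_nn_integral) (auto simp: nn_integral_completion I_def)
      qed
      \<comment> \<open>On \<Omega> the functions \<open>z (r k)\<close> and \<open>u (r k)\<close>
        agree almost everywhere, and enlarging the domain only increases the integral.\<close>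
      have "I \<longlonglongrightarrow> 0"
      proof (rule tendsto_sandwich[OF _ _ tendsto_const lim])
        have "I k \<le> (\<integral>\<^sup>+x. ennreal ((u (r k) x - w x)\<^sup>2) \<partial>lborel)" for k
          unfolding I_def using zu[of "r k"]
          by (intro nn_integral_mono_AE, eventually_elim) (auto simp: indicator_def)
        then show "\<forall>\<^sub>F k in sequentially. I k \<le> (\<integral>\<^sup>+x. ennreal ((u (r k) x - w x)\<^sup>2) \<partial>lborel)"
          by simp
      qed simp
      then have "(\<lambda>k. enn2real (I k)) \<longlonglongrightarrow> 0"
        using tendsto_enn2real[of I 0 sequentially] by simp
      then show ?thesis by (simp add: eqI)
    qed
    ultimately show ?thesis using r by blast
  qed
  ultimately show ?thesis by blast
qed

end
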